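(* There is a constant $c\ge1$ such that, for any $n\ge 1$, the usual "basis" $\{e_{ij}\mid 1\le i,j\le n\}$ of $S_1^n$ contains a $c$-unconditional subset of size $\ge n^{3/2}$.
   Context: $S_1^n$ is the space of $n\times n$ complex matrices with the trace norm, and $e_{ij}$ are the matrix units. For $E\subset\{1,\dots,n\}^2$, the subset $\{e_{ij}\mid(i,j)\in E\}$ is $c$-unconditional if for all scalars $(\lambda_{ij})_{(i,j)\in E}$ and all scalars $(\alpha_{ij})_{(i,j)\in E}$ with $|\alpha_{ij}|\le1$, $$\Big\|\sum_{(i,j)\in E}\alpha_{ij}\lambda_{ij}e_{ij}\Big\|_{S_1^n}\le c\,\Big\|\sum_{(i,j)\in E}\lambda_{ij}e_{ij}\Big\|_{S_1^n}.$$ *)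

theory Defs
  imports Complex_Main "Jordan_Normal_Form.Schur_Decomposition"
    "HOL-Computational_Algebra.Polynomial"
begin

text \<open>
  The singular values of \<open>A\<close> are the square roots of the eigenvalues of \<open>A\<^sup>*A\<close>, counted with
  algebraic multiplicity (as roots of the characteristic polynomial). Since \<open>A\<^sup>*A\<close> is positive
  semidefinite, its eigenvalues are real and nonnegative, so \<open>Re\<close> only changes the type.
\<close>

definition singular_values :: "complex mat \<Rightarrow> real multiset" where
  "singular_values A =
     image_mset (\<lambda>x. sqrt (Re x)) (proots (char_poly (mat_adjoint A * A)))"

definition trace_norm :: "complex mat \<Rightarrow> real" where
  "trace_norm A = sum_mset (singular_values A)"

text \<open>Matrix indices start at \<open>0\<close>, so the matrix units of size \<open>n\<close> have indices \<open>i, j < n\<close>.\<close>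

definition matrix_unit :: "nat \<Rightarrow> nat \<Rightarrow> nat \<Rightarrow> complex mat" where
  "matrix_unit n i j = mat n n (\<lambda>(k, l). if k = i \<and> l = j then 1 else 0)"

text \<open>
  The sum of \<open>a (i, j) e\<^sub>i\<^sub>j\<close> over \<open>(i, j) \<in> E\<close>, taken in the additive group of
  \<open>n \<times> n\<close> matrices; the type \<open>mat\<close> does not fix dimensions and so has no \<open>sum\<close>.
\<close>

definition unit_combination ::
    "nat \<Rightarrow> (nat \<times> nat) set \<Rightarrow> (nat \<times> nat \<Rightarrow> complex) \<Rightarrow> complex mat" where
  "unit_combination n E a =
     finsum (module_mat TYPE(complex) n n) (\<lambda>(i, j). a (i, j) \<cdot>\<^sub>m matrix_unit n i j) E"

definition unconditional_units :: "real \<Rightarrow> nat \<Rightarrow> (nat \<times> nat) set \<Rightarrow> bool" where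
  "unconditional_units c n E \<longleftrightarrow>
     (\<forall>x \<alpha> :: nat \<times> nat \<Rightarrow> complex. (\<forall>p\<in>E. cmod (\<alpha> p) \<le> 1) \<longrightarrow>
        trace_norm (unit_combination n E (\<lambda>p. \<alpha> p * x p))
          \<le> c * trace_norm (unit_combination n E x))"

lemma unit_combination_eq_mat:
  assumes "E \<subseteq> {..<n} \<times> {..<n}"
  shows "unit_combination n E a = mat n n (\<lambda>p. if p \<in> E then a p else 0)"
proof -
  let ?V = "module_mat TYPE(complex) n n"
  let ?f = "\<lambda>(i, j). a (i, j) \<cdot>\<^sub>m matrix_unit n i j"
  interpret abelian_group ?V by (rule abelian_group_mat)
  have fin: "finite E" using assms by (rule finite_subset) auto
  have f: "?f \<in> F \<rightarrow> carrier ?V" for F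
    by (auto simp: module_mat_simps matrix_unit_def)
  from fin have "finsum ?V ?f E = mat n n (\<lambda>p. if p \<in> E then a p else 0)"
    using assms
  proof (induction E rule: finite_induct)
    case empty
    show ?case by (auto simp: module_mat_simps)
  next
    case (insert p F)
    obtain i j where p: "p = (i, j)" by force
    have "finsum ?V ?f (insert p F) = ?f p + finsum ?V ?f F"
      using insert.hyps f finsum_insert[of F p ?f] 
      by (simp add: module_mat_simps matrix_unit_def p)
    also have "\<dots> = mat n n (\<lambda>q. if q \<in> insert p F then a q else 0)"
      using insert by (auto simp: p matrix_unit_def intro!: eq_matI)
    finally show ?case .
  qed
  then show ?thesis by (simp add: unit_combination_def)
qed

end

theory Submission
  imports Defs "HOL-Algebra.Algebraic_Closure_Type" "HOL-Library.Z2" "HOL-Analysis.L2_Norm"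
begin

text \<open>
  A set \<open>E\<close> of matrix units is unconditional in the trace norm as soon as the incidence pattern \<open>E\<close> has
  few rectangles, and patterns of size \<open>n\<^sup>3\<^sup>/\<^sup>2\<close> with few rectangles come from affine planes.

  For matrices \<open>x\<close> supported on \<open>E\<close>, the trace norm is compared with the norm dual to the largest length of
  a row or column, that is, the supremum of the pairing of \<open>x\<close> with matrices \<open>y\<close> supported on \<open>E\<close> whose
  rows and columns have length at most 1 (\<open>admissible\<close>). This norm obviously does not grow when the
  entries of \<open>x\<close> are multiplied by scalars of modulus at most 1, and it dominates the trace norm, since the
  rows and columns of a contraction have length at most 1. What has to be shown is that the trace norm
  dominates it up to a constant (\<open>pairing_le_sparse\<close>).

  An admissible \<open>y\<close> may have a large operator norm. But if \<open>E\<close> has few rectangles, the diagonal entries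
  of \<open>(y\<^sup>*y)\<^sup>2\<close> and \<open>(y y\<^sup>*)\<^sup>2\<close> are bounded by a constant \<open>M\<close> (\<open>fourth_moment_le\<close>). Truncating the singular
  values of \<open>y\<close> smoothly near \<open>\<surd>M\<close> therefore writes \<open>y = f + g\<close> where \<open>f\<close> has operator norm at most
  \<open>\<surd>M / 2\<close>, and where \<open>g\<^sup>*g \<le> (y\<^sup>*y)\<^sup>2 / (4 M)\<close> and \<open>g g\<^sup>* \<le> (y y\<^sup>*)\<^sup>2 / (4 M)\<close>, so that the rows and columns
  of \<open>g\<close> have length at most \<open>1/2\<close> (\<open>admissible_split\<close>). The pairing of \<open>x\<close> with \<open>f\<close> is at most \<open>\<surd>M / 2\<close> times
  the trace norm of \<open>x\<close>. Only the entries of \<open>g\<close> on \<open>E\<close> matter for the pairing with \<open>x\<close>, and these form half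
  an admissible matrix. So the supremum is at most \<open>\<surd>M / 2\<close> times the trace norm plus half of itself, which
  gives the constant \<open>\<surd>M\<close>.

  The incidence relation of points and non-vertical lines in the affine plane over the field with \<open>q = 2\<^sup>j\<close>
  elements has no rectangles, and has \<open>q\<^sup>3\<close> incidences on \<open>q\<^sup>2 \<times> q\<^sup>2\<close> indices. Replacing every index by a
  bounded number of copies gives patterns of the required size for all \<open>n\<close> (\<open>ex_large_pattern\<close>), with \<open>M = 32\<close>.
\<close>

(* The infix of power series coefficients would clash with that of vector entries. *)
unbundle no Formal_Power_Series.fps_syntax

section \<open>Unitary diagonalisation of Hermitian matrices\<close>

lemma dim_mat_adjoint [simp]:
  "dim_row (mat_adjoint A) = dim_col A" "dim_col (mat_adjoint A) = dim_row A"
  by (simp_all add: mat_adjoint_def)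

lemma mat_adjoint_carrier [simp]: "A \<in> carrier_mat n m \<Longrightarrow> mat_adjoint A \<in> carrier_mat m n"
  by (rule carrier_matI) auto

lemma index_mat_adjoint [simp]:
  "i < dim_col A \<Longrightarrow> j < dim_row A \<Longrightarrow> mat_adjoint A $$ (i, j) = conjugate (A $$ (j, i))"
  by (simp add: mat_adjoint_def mat_of_rows_def)

lemma mat_adjoint_mult:
  fixes A B :: "complex mat"
  assumes "A \<in> carrier_mat n m" "B \<in> carrier_mat m k"
  shows "mat_adjoint (A * B) = mat_adjoint B * mat_adjoint A"
  using assms
  by (intro eq_matI) (auto simp: scalar_prod_def conjugate_complex_def mult.commute intro!: sum.cong)

lemma mat_adjoint_adjoint [simp]: "mat_adjoint (mat_adjoint A) = (A :: complex mat)"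
  by (intro eq_matI) auto

lemma cscalar_prod_self:
  fixes u :: "complex vec"
  shows "u \<bullet>c u = of_real (\<Sum>i<dim_vec u. (cmod (u $ i))\<^sup>2)"
  by (simp add: scalar_prod_def conjugate_complex_def complex_norm_square atLeast0LessThan del: of_real_power)

text \<open>
  Gram--Schmidt applied to a basis starting with \<open>v\<close> yields an orthogonal basis whose first
  vector is still \<open>v\<close>; dividing by the lengths leaves \<open>v\<close> alone because it is a unit vector.
\<close>

lemma orthonormal_basis_extending:
  fixes v :: "complex vec"
  assumes v: "v \<in> carrier_vec n" and unit: "v \<bullet>c v = 1"
  obtains ws where "set ws \<subseteq> carrier_vec n" "length ws = n" "hd ws = v"
    "\<And>i j. i < n \<Longrightarrow> j < n \<Longrightarrow> ws ! i \<bullet>c ws ! j = (if i = j then 1 else 0)"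
proof -
  define b where "b = basis_completion v"
  define us where "us = gram_schmidt n b"
  have v0: "v \<noteq> 0\<^sub>v n"
    using unit v by auto
  then have n: "n \<noteq> 0" using v by auto
  interpret cof_vec_space n "TYPE(complex)" .
  from basis_completion[OF v v0, folded b_def]
  have dist_b: "distinct b"
    and indep: "\<not> lin_dep (set b)" and b: "set b \<subseteq> carrier_vec n" and hdb: "hd b = v" 
    and len_b: "length b = n" by auto
  from hdb len_b n obtain vs where bv: "b = v # vs" by (cases b, auto)
  from gram_schmidt_result[OF b dist_b indep refl, folded us_def]
  have us: "set us \<subseteq> carrier_vec n" "corthogonal us" "length us = n" 
    by (auto simp: len_b)
  from gram_schmidt_hd[OF v, of vs, folded bv] have hdus: "hd us = v" unfolding us_def .
  define r where "r u = sqrt (\<Sum>i<dim_vec u. (cmod (u $ i))\<^sup>2)" for u :: "complex vec"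
  have r: "u \<bullet>c u = of_real ((r u)\<^sup>2)" for u
    by (simp add: cscalar_prod_self r_def sum_nonneg)
  have r_pos: "r (us ! i) \<noteq> 0" if "i < n" for i
    using us(2,3) that r[of "us ! i"] corthogonalD[OF us(2), of i i] by auto
  define ws where "ws = map (\<lambda>u. complex_of_real (1 / r u) \<cdot>\<^sub>v u) us"
  show thesis
  proof
    show "set ws \<subseteq> carrier_vec n" using us by (auto simp: ws_def)
    show len: "length ws = n" by (simp add: ws_def us)
    have "(r v)\<^sup>2 = 1"
      using r[of v] unit by (metis of_real_eq_1_iff)
    moreover have "r v \<ge> 0" by (simp add: r_def sum_nonneg)
    ultimately have "r v = 1" by (auto simp: power2_eq_1_iff)
    then show "hd ws = v"
      using hdus us(3) n by (cases us) (auto simp: ws_def)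
    fix i j assume ij: "i < n" "j < n"
    have c: "us ! i \<in> carrier_vec n" "us ! j \<in> carrier_vec n" using us ij by auto
    have "ws ! i \<bullet>c ws ! j = of_real (1 / r (us ! i) * (1 / r (us ! j))) * (us ! i \<bullet>c us ! j)"
      using c ij us(3) by (simp add: ws_def scalar_prod_def conjugate_complex_def sum_distrib_left mult_ac)
    also have "\<dots> = (if i = j then 1 else 0)"
      using r_pos ij corthogonalD[OF us(2), of i j] us(3) r[of "us ! i"]
      by (auto simp: power2_eq_square simp flip: of_real_mult)
    finally show "ws ! i \<bullet>c ws ! j = (if i = j then 1 else 0)" .
  qed
qed

lemma unit_eigenvector:
  assumes A: "A \<in> carrier_mat n n" and e: "eigenvalue A (e :: complex)"
  obtains v where "v \<in> carrier_vec n" "v \<bullet>c v = 1" "A *\<^sub>v v = e \<cdot>\<^sub>v v"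
proof -
  from e A obtain w where w: "w \<in> carrier_vec n" "w \<noteq> 0\<^sub>v n" "A *\<^sub>v w = e \<cdot>\<^sub>v w"
    by (auto simp: eigenvalue_def eigenvector_def)
  define r where "r = sqrt (\<Sum>i<dim_vec w. (cmod (w $ i))\<^sup>2)"
  have r: "w \<bullet>c w = of_real (r\<^sup>2)"
    by (simp add: cscalar_prod_self r_def sum_nonneg)
  have r0: "r \<noteq> 0"
    using r w conjugate_square_eq_0_vec[OF w(1)] by auto
  show thesis
  proof
    show "complex_of_real (1 / r) \<cdot>\<^sub>v w \<in> carrier_vec n" using w by auto
    have "(complex_of_real (1 / r) \<cdot>\<^sub>v w) \<bullet>c (complex_of_real (1 / r) \<cdot>\<^sub>v w) = of_real (1 / r * (1 / r)) * (w \<bullet>c w)"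
      by (simp add: scalar_prod_def conjugate_complex_def sum_distrib_left mult_ac)
    also have "\<dots> = 1"
      using r0 by (simp add: r power2_eq_square)
    finally show "(complex_of_real (1 / r) \<cdot>\<^sub>v w) \<bullet>c (complex_of_real (1 / r) \<cdot>\<^sub>v w) = 1" .
    show "A *\<^sub>v (complex_of_real (1 / r) \<cdot>\<^sub>v w) = e \<cdot>\<^sub>v (complex_of_real (1 / r) \<cdot>\<^sub>v w)"
      using w A by (simp add: mult_mat_vec smult_smult_assoc mult.commute)
  qed
qed

text \<open>
  The spectral theorem, with the eigenvalues listed in a prescribed order and with algebraic
  multiplicity; the multiplicities matter because the singular values are defined through the
  roots of a characteristic polynomial. Deflation: complete a unit eigenvector to an orthonormal
  basis. In that basis the first column vanishes below the diagonal, hence so does the first row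
  beyond it, and the remaining block is Hermitian with the remaining eigenvalues.
\<close>

lemma hermitian_diagonalization:
  fixes A :: "complex mat"
  assumes "A \<in> carrier_mat n n" "mat_adjoint A = A" "char_poly A = (\<Prod>e\<leftarrow>es. [:-e, 1:])"
  shows "\<exists>P. similar_mat_wit A (mat n n (\<lambda>(i, j). if i = j then es ! i else 0)) P (mat_adjoint P)"
  using assms
proof (induction es arbitrary: n A)
  case Nil
  with degree_monic_char_poly[of A n] have n: "n = 0" by auto
  have "similar_mat_wit A (mat n n (\<lambda>(i, j). if i = j then [] ! i else 0)) (1\<^sub>m 0) (mat_adjoint (1\<^sub>m 0))"
    using Nil(1) unfolding n by (intro similar_mat_witI[of _ _ 0]) (auto intro!: eq_matI)
  then show ?case by blast
next
  case (Cons e es n A)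
  note A = Cons.prems(1) and herm = Cons.prems(2)
  let ?n1 = "n - 1"
  let ?cp = "char_poly A"
  have cp: "?cp = [: -e, 1 :] * (\<Prod>e \<leftarrow> es. [:- e, 1:])" using Cons.prems(3) by auto
  have mon: "monic (\<Prod>e\<leftarrow> es. [:- e, 1:])" by (rule monic_prod_list, auto)
  have deg: "Polynomial.degree ?cp = Suc (Polynomial.degree (\<Prod>e\<leftarrow> es. [:- e, 1:]))" unfolding cp
    by (subst degree_mult_eq, insert mon, auto)
  with degree_monic_char_poly[OF A] have n: "n \<noteq> 0" by auto
  have e: "eigenvalue A e" 
    unfolding eigenvalue_root_char_poly[OF A] cp by simp
  obtain v where v: "v \<in> carrier_vec n" "v \<bullet>c v = 1" "A *\<^sub>v v = e \<cdot>\<^sub>v v"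
    using unit_eigenvector[OF A e] by blast
  have v0: "v \<noteq> 0\<^sub>v n" using v by auto
  obtain ws where ws: "set ws \<subseteq> carrier_vec n" "length ws = n" "hd ws = v"
    and orth: "\<And>i j. i < n \<Longrightarrow> j < n \<Longrightarrow> ws ! i \<bullet>c ws ! j = (if i = j then 1 else 0)"
    using orthonormal_basis_extending[OF v(1,2)] by blast
  have corth: "corthogonal ws" using orth ws(2) by (intro corthogonalI) auto
  define W where "W = mat_of_cols n ws"
  have W: "W \<in> carrier_mat n n" using ws(2) mat_of_cols_carrier(1)[of n ws] by (simp add: W_def)
  have W': "mat_adjoint W \<in> carrier_mat n n" using W by simp
  have vec_inv_ws: "vec_inv (ws ! i) = conjugate (ws ! i)" if "i < n" for i
    using orth[OF that that] by (simp add: vec_inv_def)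
  \<comment> \<open>\<open>vec_inv\<close> divides by the squared length, which is 1 here.\<close>
  have adj: "corthogonal_inv W = mat_adjoint W"
    using vec_inv_ws ws unfolding corthogonal_inv_def mat_adjoint_def W_def
    by (intro arg_cong[of _ _ "mat_of_rows _"]) (auto simp: in_set_conv_nth)
  define A' where "A' = mat_adjoint W * A * W"
  have A': "A' \<in> carrier_mat n n" using W A unfolding A'_def by auto
  have orthW: "corthogonal_mat W"
    unfolding W_def by (rule orthogonal_mat_of_cols[OF ws(1) corth ws(2)])
  have W'W: "mat_adjoint W * W = 1\<^sub>m n"
    using corthogonal_inv_result[OF orthW] W by (simp add: adj inverts_mat_def)
  have WW': "W * mat_adjoint W = 1\<^sub>m n"
    using mat_mult_left_right_inverse[OF W' W W'W] .
  have simAA': "similar_mat_wit A A' W (mat_adjoint W)"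
  proof (rule similar_mat_witI[OF WW' W'W _ A A' W W'])
    have "W * A' * mat_adjoint W = (W * mat_adjoint W) * A * (W * mat_adjoint W)"
      using A W W' unfolding A'_def by (simp add: assoc_mult_mat[of _ n n _ n _ n] mult_carrier_mat[of _ n n _ n])
    then show "A = W * A' * mat_adjoint W" using A by (simp add: WW')
  qed
  have herm': "mat_adjoint A' = A'"
    using A W W' herm unfolding A'_def
    by (simp add: mat_adjoint_mult[of _ n n _ n] assoc_mult_mat[of _ n n _ n _ n] mult_carrier_mat[of _ n n _ n])
  have col0: "col A' 0 = vec n (\<lambda> i. if i = 0 then e else 0)"
    unfolding A'_def adj[symmetric] unfolding W_def
    using corthogonal_col_ev_0[OF A v(1) v0 v(3) n ws(3,1) corth ws(2)] .
  have A'0: "A' $$ (i, 0) = (if i = 0 then e else 0)" if "i < n" for i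
    using arg_cong[OF col0, of "\<lambda>v. v $ i"] that A' n by auto
  have A'0': "A' $$ (0, i) = 0" if "i < n" "i \<noteq> 0" for i
  proof -
    have "A' $$ (0, i) = mat_adjoint A' $$ (0, i)" by (simp add: herm')
    also have "\<dots> = conjugate (A' $$ (i, 0))" using A' that n by (subst index_mat_adjoint) auto
    finally show ?thesis using A'0[of i] that by simp
  qed
  define A3 where "A3 = mat ?n1 ?n1 (\<lambda>(i, j). A' $$ (Suc i, Suc j))"
  have A3: "A3 \<in> carrier_mat ?n1 ?n1" by (simp add: A3_def)
  define A1 where "A1 = mat 1 1 (\<lambda>_. e)"
  have A1: "A1 \<in> carrier_mat 1 1" by (simp add: A1_def)
  have block: "A' = four_block_mat A1 (0\<^sub>m 1 ?n1) (0\<^sub>m ?n1 1) A3"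
    using A' n A'0 A'0' by (intro eq_matI) (auto simp: A1_def A3_def)
  have herm3: "mat_adjoint A3 = A3"
  proof (rule eq_matI)
    fix i j assume ij: "i < dim_row A3" "j < dim_col A3"
    then have "conjugate (A' $$ (Suc j, Suc i)) = A' $$ (Suc i, Suc j)"
      using A' index_mat_adjoint[of "Suc i" A' "Suc j"] by (auto simp: herm' A3_def)
    then show "mat_adjoint A3 $$ (i, j) = A3 $$ (i, j)"
      using ij by (subst index_mat_adjoint) (auto simp: A3_def)
  qed (auto simp: A3_def)
  have "similar_mat A A'" using simAA' unfolding similar_mat_def by blast
  then have "char_poly A' = [: -e,1 :] * (\<Prod> e \<leftarrow> es. [:- e, 1:])"
    using char_poly_similar cp by metis
  also have "char_poly A' = char_poly A1 * char_poly A3" 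
    unfolding block
    by (rule char_poly_four_block_zeros_col[OF A1 _ A3]) simp
  also have "char_poly A1 = [: -e,1 :]"
    by (simp add: A1_def char_poly_defs det_def sign_def)
  finally have "char_poly A3 = (\<Prod> e \<leftarrow> es. [:- e, 1:])"
    by (metis mult_cancel_left pCons_eq_0_iff zero_neq_one)
  from Cons.IH[OF A3 herm3 this] obtain P where
    P: "similar_mat_wit A3 (mat ?n1 ?n1 (\<lambda>(i, j). if i = j then es ! i else 0)) P (mat_adjoint P)"
      (is "similar_mat_wit _ ?D _ _")
    by blast
  note PD = similar_mat_witD2[OF A3 P]
  let ?P = "four_block_mat (1\<^sub>m 1) (0\<^sub>m 1 ?n1) (0\<^sub>m ?n1 1) P"
  let ?Q = "four_block_mat (1\<^sub>m 1) (0\<^sub>m 1 ?n1) (0\<^sub>m ?n1 1) (mat_adjoint P)"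
  let ?D' = "four_block_mat A1 (0\<^sub>m 1 ?n1) (0\<^sub>m ?n1 1) ?D"
  have sim': "similar_mat_wit A' ?D' ?P ?Q"
    unfolding block
    by (rule similar_mat_wit_four_block[OF similar_mat_wit_refl[OF A1] P _ _ A1 A3])
      (use PD in auto)
  have Q: "?Q = mat_adjoint ?P"
    using PD(6) by (intro eq_matI) auto
  have D': "?D' = mat n n (\<lambda>(i, j). if i = j then (e # es) ! i else 0)"
    using n by (intro eq_matI) (auto simp: A1_def nth_Cons')
  have PW: "mat_adjoint ?P * mat_adjoint W = mat_adjoint (W * ?P)"
    using PD(6) W n by (intro mat_adjoint_mult[symmetric, of _ n n _ n]) auto
  then show ?case
    using similar_mat_wit_trans[OF simAA' sim'] unfolding Q D' PW by blast
qed

section \<open>Singular values and trace duality\<close>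

abbreviation vec_norm :: "nat \<Rightarrow> (nat \<Rightarrow> complex) \<Rightarrow> real" where
  "vec_norm n f \<equiv> L2_set (\<lambda>k. cmod (f k)) {..<n}"

lemma vec_norm_power2: "(vec_norm n f)\<^sup>2 = (\<Sum>k<n. (cmod (f k))\<^sup>2)"
  by (simp add: L2_set_def sum_nonneg)

lemma cauchy_schwarz_complex:
  fixes f g :: "'a \<Rightarrow> complex"
  shows "cmod (\<Sum>k\<in>A. f k * g k) \<le> L2_set (\<lambda>k. cmod (f k)) A * L2_set (\<lambda>k. cmod (g k)) A"
proof -
  have "cmod (\<Sum>k\<in>A. f k * g k) \<le> (\<Sum>k\<in>A. \<bar>cmod (f k)\<bar> * \<bar>cmod (g k)\<bar>)"
    by (rule order.trans[OF norm_sum]) (simp add: norm_mult)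
  also have "\<dots> \<le> L2_set (\<lambda>k. cmod (f k)) A * L2_set (\<lambda>k. cmod (g k)) A"
    by (rule L2_set_mult_ineq)
  finally show ?thesis .
qed

definition orthonormal :: "nat \<Rightarrow> 'i set \<Rightarrow> ('i \<Rightarrow> nat \<Rightarrow> complex) \<Rightarrow> bool" where
  "orthonormal n J v \<longleftrightarrow> finite J \<and>
     (\<forall>i\<in>J. \<forall>i'\<in>J. (\<Sum>k<n. cnj (v i k) * v i' k) = (if i = i' then 1 else 0))"

lemma orthonormal_cnj: "orthonormal n J v \<Longrightarrow> orthonormal n J (\<lambda>i k. cnj (v i k))"
  by (simp add: orthonormal_def mult.commute)

lemma orthonormal_norm: "orthonormal n J v \<Longrightarrow> i \<in> J \<Longrightarrow> vec_norm n (v i) = 1"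
proof -
  assume v: "orthonormal n J v" and i: "i \<in> J"
  have "complex_of_real (\<Sum>k<n. (cmod (v i k))\<^sup>2) = (\<Sum>k<n. cnj (v i k) * v i k)"
    by (simp add: complex_norm_square mult.commute del: of_real_power)
  also have "\<dots> = 1" using v i by (simp add: orthonormal_def)
  finally show ?thesis by (simp only: of_real_eq_1_iff L2_set_def real_sqrt_one)
qed

lemma orthonormal_pythagoras:
  assumes "orthonormal n J v"
  shows "(\<Sum>k<n. (cmod (\<Sum>i\<in>J. c i * v i k))\<^sup>2) = (\<Sum>i\<in>J. (cmod (c i))\<^sup>2)"
proof -
  have "complex_of_real (\<Sum>k<n. (cmod (\<Sum>i\<in>J. c i * v i k))\<^sup>2)
      = (\<Sum>k<n. \<Sum>i'\<in>J. \<Sum>i\<in>J. c i' * cnj (c i) * (cnj (v i k) * v i' k))"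
    by (simp add: complex_norm_square sum_product mult_ac del: of_real_power)
  also have "\<dots> = (\<Sum>i'\<in>J. \<Sum>i\<in>J. c i' * cnj (c i) * (\<Sum>k<n. cnj (v i k) * v i' k))"
    by (subst sum.swap, intro sum.cong refl, subst sum.swap) (simp add: sum_distrib_left)
  also have "\<dots> = (\<Sum>i'\<in>J. \<Sum>i\<in>J. if i = i' then c i' * cnj (c i) else 0)"
    using assms by (intro sum.cong refl) (auto simp: orthonormal_def)
  also have "\<dots> = complex_of_real (\<Sum>i\<in>J. (cmod (c i))\<^sup>2)"
    using assms by (simp add: complex_norm_square orthonormal_def del: of_real_power)
  finally show ?thesis by (simp only: of_real_eq_iff)
qed

text \<open>
  The projection \<open>p = \<Sum>c\<^sub>i v\<^sub>i\<close> of \<open>w\<close> satisfies \<open>\<parallel>p\<parallel>\<^sup>2 = \<Sum>\<bar>c\<^sub>i\<bar>\<^sup>2 = \<langle>p, w\<rangle>\<close>, so Cauchy--Schwarz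
  bounds its length by that of \<open>w\<close>. The coefficients are bilinear, not sesquilinear, in \<open>v\<close> and
  \<open>w\<close>; this loses nothing since the conjugate of an orthonormal family is orthonormal.
\<close>

lemma bessel_inequality:
  assumes v: "orthonormal n J v"
  shows "L2_set (\<lambda>i. cmod (\<Sum>k<n. v i k * w k)) J \<le> vec_norm n w"
proof -
  define c where "c i = (\<Sum>k<n. v i k * w k)" for i
  define B where "B = L2_set (\<lambda>i. cmod (c i)) J"
  have B2: "B\<^sup>2 = (\<Sum>i\<in>J. (cmod (c i))\<^sup>2)" by (simp add: B_def L2_set_def sum_nonneg)
  have "complex_of_real (B\<^sup>2) = (\<Sum>i\<in>J. cnj (c i) * c i)"
    unfolding B2 by (simp add: complex_norm_square mult.commute del: of_real_power)
  also have "\<dots> = (\<Sum>i\<in>J. \<Sum>k<n. cnj (c i) * v i k * w k)"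
    unfolding c_def by (simp add: sum_distrib_left mult.assoc)
  also have "\<dots> = (\<Sum>k<n. (\<Sum>i\<in>J. cnj (c i) * v i k) * w k)"
    by (subst sum.swap) (simp add: sum_distrib_right)
  finally have "B\<^sup>2 = cmod (\<Sum>k<n. (\<Sum>i\<in>J. cnj (c i) * v i k) * w k)"
    by (metis abs_of_nonneg norm_of_real zero_le_power2)
  also have "\<dots> \<le> vec_norm n (\<lambda>k. \<Sum>i\<in>J. cnj (c i) * v i k) * vec_norm n w"
    by (rule cauchy_schwarz_complex)
  also have "vec_norm n (\<lambda>k. \<Sum>i\<in>J. cnj (c i) * v i k) = B"
    by (simp add: L2_set_def orthonormal_pythagoras[OF v] B_def)
  finally have "B * B \<le> B * vec_norm n w" by (simp add: power2_eq_square)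
  moreover have "B \<ge> 0" by (simp add: B_def)
  ultimately have "B \<le> vec_norm n w"
    by (metis L2_set_nonneg mult_le_cancel_left order_le_less)
  then show ?thesis by (simp add: B_def c_def)
qed

text \<open>
  The reduced form, restricted to the nonzero singular values: it treats the left and right
  singular vectors alike, so that passing to the adjoint matrix just exchanges them.
\<close>

definition singular_decomposition ::
  "nat \<Rightarrow> 'i set \<Rightarrow> ('i \<Rightarrow> real) \<Rightarrow> ('i \<Rightarrow> nat \<Rightarrow> complex) \<Rightarrow> ('i \<Rightarrow> nat \<Rightarrow> complex) \<Rightarrow>
    (nat \<Rightarrow> nat \<Rightarrow> complex) \<Rightarrow> bool" where
  "singular_decomposition n J s v u a \<longleftrightarrow>
     (\<forall>i\<in>J. s i > 0) \<and> orthonormal n J v \<and> orthonormal n J u \<and>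
     (\<forall>k<n. \<forall>j<n. a k j = (\<Sum>i\<in>J. of_real (s i) * v i k * cnj (u i j)))"

lemma singular_decomposition_adjoint:
  "singular_decomposition n J s v u a \<Longrightarrow> singular_decomposition n J s u v (\<lambda>j k. cnj (a k j))"
  by (auto simp: singular_decomposition_def mult_ac)

lemma proots_prod_linear_factors:
  fixes es :: "'a :: idom list"
  shows "proots (\<Prod>e\<leftarrow>es. [:-e, 1:]) = mset es"
proof (induction es)
  case (Cons e es)
  have "(\<Prod>e\<leftarrow>es. [:-e, 1:]) \<noteq> 0" by (auto simp: prod_list_zero_iff)
  then show ?case using Cons by (simp add: proots_mult del: mult_pCons_left)
qed simp

text \<open>
  Diagonalise \<open>A\<^sup>*A = P D P\<^sup>*\<close> and put \<open>B = A P\<close>. Then \<open>B\<^sup>*B = D\<close>, so the columns of \<open>B\<close>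
  are orthogonal and their lengths are the singular values; the left singular vectors are the
  normalised nonzero columns, and \<open>A = B P\<^sup>*\<close> is the decomposition.
\<close>

lemma ex_singular_decomposition:
  assumes A: "A \<in> carrier_mat n n"
  shows "\<exists>(J :: nat set) s v u. singular_decomposition n J s v u (\<lambda>k j. A $$ (k, j)) \<and>
    trace_norm A = (\<Sum>i\<in>J. s i)"
proof -
  define H where "H = mat_adjoint A * A"
  have H: "H \<in> carrier_mat n n" using A by (auto simp: H_def)
  obtain es where es: "char_poly H = (\<Prod>e\<leftarrow>es. [:-e, 1:])" "length es = n"
    using char_poly_factorized[OF H] by blast
  have "mat_adjoint H = H"
    using A by (simp add: H_def mat_adjoint_mult[of _ n n _ n])
  from hermitian_diagonalization[OF H this es(1)] obtain P where
    P: "similar_mat_wit H (mat n n (\<lambda>(i, j). if i = j then es ! i else 0)) P (mat_adjoint P)"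
      (is "similar_mat_wit _ ?D _ _") ..
  note PD = similar_mat_witD2[OF H P]
  define B where "B = A * P"
  have B: "B \<in> carrier_mat n n" using A PD by (auto simp: B_def)
  have "A = A * (P * mat_adjoint P)" using A PD by simp
  also have "\<dots> = B * mat_adjoint P"
    using A PD(6,7) by (simp add: B_def assoc_mult_mat[of _ n n _ n _ n])
  finally have AB: "A = B * mat_adjoint P" .
  have "mat_adjoint B * B = mat_adjoint P * H * P"
    using A PD(6,7)
    by (simp add: B_def H_def mat_adjoint_mult[of _ n n _ n] assoc_mult_mat[of _ n n _ n _ n]
      mult_carrier_mat[of _ n n _ n])
  also have "\<dots> = mat_adjoint P * (P * ?D * mat_adjoint P) * P"
    by (simp only: PD(3)[symmetric])
  also have "\<dots> = (mat_adjoint P * P) * ?D * (mat_adjoint P * P)"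
    using PD(5-7) by (simp add: assoc_mult_mat[of _ n n _ n _ n] mult_carrier_mat[of _ n n _ n])
  finally have BB: "mat_adjoint B * B = ?D" by (simp add: PD(2))
  have BB': "(\<Sum>k<n. cnj (B $$ (k, i)) * B $$ (k, i')) = (if i = i' then es ! i else 0)"
    if "i < n" "i' < n" for i i'
    using arg_cong[OF BB, of "\<lambda>Y. Y $$ (i, i')"] that B
    by (simp add: scalar_prod_def conjugate_complex_def atLeast0LessThan)
  have PP': "(\<Sum>k<n. cnj (P $$ (k, i)) * P $$ (k, i')) = (if i = i' then 1 else 0)"
    if "i < n" "i' < n" for i i'
    using arg_cong[OF PD(2), of "\<lambda>Y. Y $$ (i, i')"] that PD(6)
    by (simp add: scalar_prod_def conjugate_complex_def atLeast0LessThan)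
  define s where "s i = sqrt (Re (es ! i))" for i
  have es_nonneg: "es ! i = of_real (\<Sum>k<n. (cmod (B $$ (k, i)))\<^sup>2)" if "i < n" for i
    using BB'[OF that that] by (simp add: complex_norm_square mult.commute del: of_real_power)
  have s2: "es ! i = of_real ((s i)\<^sup>2)" and s0: "s i \<ge> 0" if "i < n" for i
    using es_nonneg[OF that] by (simp_all add: s_def sum_nonneg)
  define J where "J = {i. i < n \<and> s i \<noteq> 0}"
  define v where "v i k = B $$ (k, i) / of_real (s i)" for i k
  define u where "u i j = P $$ (j, i)" for i j
  have zero: "B $$ (k, i) = 0" if "i < n" "k < n" "s i = 0" for i k
  proof -
    have "complex_of_real (\<Sum>k<n. (cmod (B $$ (k, i)))\<^sup>2) = 0"
      using es_nonneg[OF that(1)] s2[OF that(1)] that(3) by simp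
    then have "(\<Sum>k<n. (cmod (B $$ (k, i)))\<^sup>2) = 0" by (simp only: of_real_eq_0_iff)
    then show ?thesis using that(2) by (simp add: sum_nonneg_eq_0_iff)
  qed
  have "singular_decomposition n J s v u (\<lambda>k j. A $$ (k, j))"
    unfolding singular_decomposition_def
  proof (intro conjI ballI allI impI)
    show "s i > 0" if "i \<in> J" for i using that s0[of i] by (auto simp: J_def)
    show "orthonormal n J u"
      unfolding orthonormal_def using PP' by (auto simp: J_def u_def)
    show "orthonormal n J v"
      unfolding orthonormal_def
    proof (intro conjI ballI)
      fix i i' assume i: "i \<in> J" "i' \<in> J"
      have "(\<Sum>k<n. cnj (v i k) * v i' k) = (\<Sum>k<n. cnj (B $$ (k, i)) * B $$ (k, i')) / of_real (s i * s i')"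
        by (simp add: v_def sum_divide_distrib)
      then show "(\<Sum>k<n. cnj (v i k) * v i' k) = (if i = i' then 1 else 0)"
        using i BB'[of i i'] s2[of i] by (auto simp: J_def power2_eq_square)
    qed (simp add: J_def)
    fix k j assume kj: "k < n" "j < n"
    have "A $$ (k, j) = (\<Sum>i<n. B $$ (k, i) * cnj (P $$ (j, i)))"
      using kj B PD(6) by (subst AB) (simp add: scalar_prod_def conjugate_complex_def atLeast0LessThan)
    also have "\<dots> = (\<Sum>i\<in>J. B $$ (k, i) * cnj (P $$ (j, i)))"
      using zero kj by (intro sum.mono_neutral_right) (auto simp: J_def)
    also have "\<dots> = (\<Sum>i\<in>J. of_real (s i) * v i k * cnj (u i j))"
      by (intro sum.cong refl) (auto simp: J_def v_def u_def)
    finally show "A $$ (k, j) = (\<Sum>i\<in>J. of_real (s i) * v i k * cnj (u i j))" .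
  qed
  moreover have "trace_norm A = (\<Sum>i\<in>J. s i)"
  proof -
    have "proots (char_poly H) = mset es"
      unfolding es(1) by (rule proots_prod_linear_factors)
    then have "trace_norm A = sum_mset (image_mset (\<lambda>x. sqrt (Re x)) (mset es))"
      by (simp add: trace_norm_def singular_values_def H_def)
    also have "\<dots> = (\<Sum>x\<leftarrow>es. sqrt (Re x))"
      by (metis mset_map sum_mset_sum_list)
    also have "\<dots> = (\<Sum>i<n. s i)"
      by (simp add: sum_list_sum_nth es(2) s_def atLeast0LessThan)
    also have "\<dots> = (\<Sum>i\<in>J. s i)"
      by (intro sum.mono_neutral_right) (auto simp: J_def)
    finally show ?thesis .
  qed
  ultimately show ?thesis by blast
qed

definition op_bounded :: "nat \<Rightarrow> real \<Rightarrow> (nat \<Rightarrow> nat \<Rightarrow> complex) \<Rightarrow> bool" where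
  "op_bounded n T z \<longleftrightarrow>
     (\<forall>\<xi> \<eta>. cmod (\<Sum>k<n. \<Sum>j<n. \<xi> k * z k j * \<eta> j) \<le> T * vec_norm n \<xi> * vec_norm n \<eta>)"

text \<open>
  Trace duality is used in bilinear form: \<open>pairing n a z\<close> is the trace of \<open>a\<close> times the transpose
  of \<open>z\<close>. Transposition preserves the operator norm, so the dual norm of the trace norm is the
  same as for the usual trace pairing, and no conjugations have to be carried along.
\<close>

definition pairing :: "nat \<Rightarrow> (nat \<Rightarrow> nat \<Rightarrow> complex) \<Rightarrow> (nat \<Rightarrow> nat \<Rightarrow> complex) \<Rightarrow> complex" where
  "pairing n a z = (\<Sum>k<n. \<Sum>j<n. a k j * z k j)"

text \<open>
  Matrices with singular values at most \<open>T\<close> have operator norm at most \<open>T\<close>: Cauchy--Schwarz in the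
  summation index, followed by Bessel's inequality for each of the two families.
\<close>

lemma op_bounded_orthonormal_sum:
  assumes v: "orthonormal n J v" and w: "orthonormal n J w"
    and t: "\<And>i. i \<in> J \<Longrightarrow> \<bar>t i\<bar> \<le> T" and T: "T \<ge> 0"
  shows "op_bounded n T (\<lambda>k j. \<Sum>i\<in>J. of_real (t i) * v i k * w i j)"
  unfolding op_bounded_def
proof (intro allI)
  fix \<xi> \<eta> :: "nat \<Rightarrow> complex"
  define p where "p i = (\<Sum>k<n. v i k * \<xi> k)" for i
  define q where "q i = (\<Sum>j<n. w i j * \<eta> j)" for i
  have "(\<Sum>k<n. \<Sum>j<n. \<xi> k * (\<Sum>i\<in>J. of_real (t i) * v i k * w i j) * \<eta> j)
      = (\<Sum>k<n. \<Sum>j<n. \<Sum>i\<in>J. of_real (t i) * (v i k * \<xi> k) * (w i j * \<eta> j))"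
    by (simp add: sum_distrib_left sum_distrib_right mult_ac)
  also have "\<dots> = (\<Sum>k<n. \<Sum>i\<in>J. \<Sum>j<n. of_real (t i) * (v i k * \<xi> k) * (w i j * \<eta> j))"
    by (intro sum.cong refl sum.swap)
  also have "\<dots> = (\<Sum>i\<in>J. \<Sum>k<n. \<Sum>j<n. of_real (t i) * (v i k * \<xi> k) * (w i j * \<eta> j))"
    by (rule sum.swap)
  also have "\<dots> = (\<Sum>i\<in>J. (of_real (t i) * p i) * q i)"
    by (simp add: p_def q_def sum_distrib_left sum_distrib_right mult_ac)
  finally have "cmod (\<Sum>k<n. \<Sum>j<n. \<xi> k * (\<Sum>i\<in>J. of_real (t i) * v i k * w i j) * \<eta> j)
      = cmod (\<Sum>i\<in>J. (of_real (t i) * p i) * q i)" by simp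
  also have "\<dots> \<le> L2_set (\<lambda>i. cmod (of_real (t i) * p i)) J * L2_set (\<lambda>i. cmod (q i)) J"
    by (rule cauchy_schwarz_complex)
  also have "\<dots> \<le> L2_set (\<lambda>i. T * cmod (p i)) J * L2_set (\<lambda>i. cmod (q i)) J"
    by (intro mult_right_mono L2_set_mono L2_set_nonneg)
      (auto simp: norm_mult intro!: mult_right_mono t)
  also have "\<dots> = T * (L2_set (\<lambda>i. cmod (p i)) J * L2_set (\<lambda>i. cmod (q i)) J)"
    by (simp add: L2_set_right_distrib[OF T, symmetric])
  also have "\<dots> \<le> T * (vec_norm n \<xi> * vec_norm n \<eta>)"
    unfolding p_def q_def using T
    by (intro mult_left_mono mult_mono bessel_inequality v w L2_set_nonneg) auto
  finally show "cmod (\<Sum>k<n. \<Sum>j<n. \<xi> k * (\<Sum>i\<in>J. of_real (t i) * v i k * w i j) * \<eta> j)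
      \<le> T * vec_norm n \<xi> * vec_norm n \<eta>" by (simp add: mult.assoc)
qed

lemma pairing_singular_decomposition:
  assumes "singular_decomposition n J s v u a"
  shows "pairing n a z = (\<Sum>i\<in>J. of_real (s i) * (\<Sum>k<n. \<Sum>j<n. v i k * z k j * cnj (u i j)))"
proof -
  have "pairing n a z = (\<Sum>k<n. \<Sum>j<n. \<Sum>i\<in>J. of_real (s i) * (v i k * z k j * cnj (u i j)))"
    using assms by (auto simp: pairing_def singular_decomposition_def sum_distrib_right sum_distrib_left mult_ac intro!: sum.cong)
  also have "\<dots> = (\<Sum>k<n. \<Sum>i\<in>J. \<Sum>j<n. of_real (s i) * (v i k * z k j * cnj (u i j)))"
    by (intro sum.cong refl sum.swap)
  also have "\<dots> = (\<Sum>i\<in>J. \<Sum>k<n. \<Sum>j<n. of_real (s i) * (v i k * z k j * cnj (u i j)))"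
    by (rule sum.swap)
  finally show ?thesis by (simp add: sum_distrib_left)
qed

text \<open>
  Each rank-one term of the singular value decomposition of \<open>A\<close> pairs with \<open>z\<close> to at most \<open>T\<close>
  times its singular value.
\<close>

lemma pairing_le_trace_norm:
  assumes A: "A \<in> carrier_mat n n" and z: "op_bounded n T z"
  shows "cmod (pairing n (\<lambda>k j. A $$ (k, j)) z) \<le> T * trace_norm A"
proof -
  obtain J :: "nat set" and s v u where sd: "singular_decomposition n J s v u (\<lambda>k j. A $$ (k, j))"
    and tn: "trace_norm A = (\<Sum>i\<in>J. s i)"
    using ex_singular_decomposition[OF A] by blast
  have "cmod (pairing n (\<lambda>k j. A $$ (k, j)) z)
      \<le> (\<Sum>i\<in>J. cmod (of_real (s i) * (\<Sum>k<n. \<Sum>j<n. v i k * z k j * cnj (u i j))))"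
    unfolding pairing_singular_decomposition[OF sd] by (rule norm_sum)
  also have "\<dots> \<le> (\<Sum>i\<in>J. s i * T)"
  proof (rule sum_mono)
    fix i assume i: "i \<in> J"
    have "cmod (\<Sum>k<n. \<Sum>j<n. v i k * z k j * cnj (u i j)) \<le> T * vec_norm n (v i) * vec_norm n (\<lambda>j. cnj (u i j))"
      using z[unfolded op_bounded_def, rule_format, of "v i" "\<lambda>j. cnj (u i j)"] .
    also have "\<dots> = T"
      using orthonormal_norm[of n J v i] orthonormal_norm[OF orthonormal_cnj, of n J u i] sd i
      by (simp add: singular_decomposition_def)
    finally show "cmod (of_real (s i) * (\<Sum>k<n. \<Sum>j<n. v i k * z k j * cnj (u i j))) \<le> s i * T"
      using sd i by (auto simp: norm_mult singular_decomposition_def intro: mult_left_mono)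
  qed
  finally show ?thesis by (simp add: tn sum_distrib_left mult.commute)
qed

text \<open>
  The maximiser is the conjugate of the polar part of \<open>A\<close>, that is, of \<open>A\<close> with all its nonzero
  singular values replaced by 1.
\<close>

lemma trace_norm_attained:
  assumes A: "A \<in> carrier_mat n n"
  obtains z where "op_bounded n 1 z" "pairing n (\<lambda>k j. A $$ (k, j)) z = of_real (trace_norm A)"
proof -
  obtain J :: "nat set" and s v u where sd: "singular_decomposition n J s v u (\<lambda>k j. A $$ (k, j))"
    and tn: "trace_norm A = (\<Sum>i\<in>J. s i)"
    using ex_singular_decomposition[OF A] by blast
  have v: "orthonormal n J v" and u: "orthonormal n J u"
    using sd by (auto simp: singular_decomposition_def)
  have fin: "finite J" using v by (simp add: orthonormal_def)
  define z where "z k j = (\<Sum>i\<in>J. of_real 1 * cnj (v i k) * u i j)" for k j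
  have inner: "(\<Sum>k<n. \<Sum>j<n. v i k * z k j * cnj (u i j)) = 1" if i: "i \<in> J" for i
  proof -
    have "(\<Sum>k<n. \<Sum>j<n. v i k * z k j * cnj (u i j))
        = (\<Sum>k<n. \<Sum>j<n. \<Sum>i'\<in>J. (cnj (v i' k) * v i k) * (cnj (u i j) * u i' j))"
      by (simp add: z_def sum_distrib_left sum_distrib_right mult_ac)
    also have "\<dots> = (\<Sum>k<n. \<Sum>i'\<in>J. \<Sum>j<n. (cnj (v i' k) * v i k) * (cnj (u i j) * u i' j))"
      by (intro sum.cong refl sum.swap)
    also have "\<dots> = (\<Sum>i'\<in>J. \<Sum>k<n. \<Sum>j<n. (cnj (v i' k) * v i k) * (cnj (u i j) * u i' j))"
      by (rule sum.swap)
    also have "\<dots> = (\<Sum>i'\<in>J. (\<Sum>k<n. cnj (v i' k) * v i k) * (\<Sum>j<n. cnj (u i j) * u i' j))"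
      by (simp add: sum_product)
    also have "\<dots> = (\<Sum>i'\<in>J. if i' = i then 1 else 0)"
      using v u i by (intro sum.cong refl) (auto simp: orthonormal_def)
    finally show ?thesis using fin i by simp
  qed
  show thesis
  proof
    show "op_bounded n 1 z"
      unfolding z_def by (rule op_bounded_orthonormal_sum[OF orthonormal_cnj[OF v] u]) auto
    show "pairing n (\<lambda>k j. A $$ (k, j)) z = of_real (trace_norm A)"
      by (simp add: pairing_singular_decomposition[OF sd] inner tn)
  qed
qed

lemma op_bounded_transpose:
  assumes "op_bounded n T z"
  shows "op_bounded n T (\<lambda>j k. z k j)"
  unfolding op_bounded_def
proof (intro allI)
  fix \<xi> \<eta> :: "nat \<Rightarrow> complex"
  have "(\<Sum>j<n. \<Sum>k<n. \<xi> j * z k j * \<eta> k) = (\<Sum>k<n. \<Sum>j<n. \<eta> k * z k j * \<xi> j)"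
    by (subst sum.swap) (simp add: mult_ac)
  then show "cmod (\<Sum>j<n. \<Sum>k<n. \<xi> j * z k j * \<eta> k) \<le> T * vec_norm n \<xi> * vec_norm n \<eta>"
    using assms[unfolded op_bounded_def, rule_format, of \<eta> \<xi>] by (simp add: mult_ac)
qed

lemma op_bounded_row:
  assumes z: "op_bounded n 1 z" and k: "k < n"
  shows "(\<Sum>j<n. (cmod (z k j))\<^sup>2) \<le> 1"
proof -
  define R where "R = vec_norm n (z k)"
  define \<xi> :: "nat \<Rightarrow> complex" where "\<xi> = (\<lambda>l. if l = k then 1 else 0)"
  have R2: "R\<^sup>2 = (\<Sum>j<n. (cmod (z k j))\<^sup>2)" by (simp add: R_def vec_norm_power2)
  have "(\<Sum>l<n. \<Sum>j<n. \<xi> l * z l j * cnj (z k j)) = (\<Sum>l<n. if l = k then (\<Sum>j<n. z k j * cnj (z k j)) else 0)"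
    by (intro sum.cong refl) (simp add: \<xi>_def)
  also have "\<dots> = of_real (R\<^sup>2)"
    using k by (simp add: R2 complex_norm_square del: of_real_power)
  finally have "R\<^sup>2 = cmod (\<Sum>l<n. \<Sum>j<n. \<xi> l * z l j * cnj (z k j))"
    by (metis abs_of_nonneg norm_of_real zero_le_power2)
  also have "\<dots> \<le> 1 * vec_norm n \<xi> * vec_norm n (\<lambda>j. cnj (z k j))"
    using z[unfolded op_bounded_def, rule_format, of \<xi> "\<lambda>j. cnj (z k j)"] .
  also have "vec_norm n \<xi> = 1"
    using k by (simp add: L2_set_def \<xi>_def if_distrib[of cmod] if_distrib[of "\<lambda>x. x\<^sup>2"] cong: if_cong)
  finally have "R\<^sup>2 \<le> R" by (simp add: R_def)
  have "R \<ge> 0" by (simp add: R_def)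
  have "R \<le> 1"
  proof (rule ccontr)
    assume "\<not> R \<le> 1"
    then have "R * 1 < R * R" using \<open>R \<ge> 0\<close> by (intro mult_strict_left_mono) auto
    with \<open>R\<^sup>2 \<le> R\<close> show False by (simp add: power2_eq_square)
  qed
  then show ?thesis using R2 \<open>R \<ge> 0\<close> power_le_one[of R 2] by simp
qed

section \<open>Patterns with few overlaps are unconditional\<close>

text \<open>
  For every column, at most \<open>t\<close> columns (possibly including itself) meet it in more than \<open>t\<close> rows.
  A rectangle-free pattern satisfies this with \<open>t = 1\<close>; the slack makes room for blown-up patterns.
\<close>

definition few_column_overlaps :: "nat \<Rightarrow> nat \<Rightarrow> (nat \<times> nat) set \<Rightarrow> bool" where
  "few_column_overlaps t n E \<longleftrightarrow>
     (\<forall>j<n. card {j'. j' < n \<and> card {k. k < n \<and> (k, j) \<in> E \<and> (k, j') \<in> E} > t} \<le> t)"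

text \<open>
  The unit ball, among matrices supported on \<open>E\<close>, of the norm given by the largest length of a row
  or column. Its dual norm is what the trace norm will turn out to be equivalent to.
\<close>

definition admissible :: "nat \<Rightarrow> (nat \<times> nat) set \<Rightarrow> (nat \<Rightarrow> nat \<Rightarrow> complex) \<Rightarrow> bool" where
  "admissible n E y \<longleftrightarrow> (\<forall>k j. (k, j) \<notin> E \<longrightarrow> y k j = 0) \<and>
     (\<forall>k<n. (\<Sum>j<n. (cmod (y k j))\<^sup>2) \<le> 1) \<and> (\<forall>j<n. (\<Sum>k<n. (cmod (y k j))\<^sup>2) \<le> 1)"

lemma admissible_adjoint: "admissible n E y \<Longrightarrow> admissible n (E\<inverse>) (\<lambda>j k. cnj (y k j))"
  by (simp add: admissible_def)

lemma cauchy_schwarz_power2: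
  fixes f g :: "'a \<Rightarrow> complex"
  shows "(cmod (\<Sum>k\<in>A. f k * g k))\<^sup>2 \<le> (\<Sum>k\<in>A. (cmod (f k))\<^sup>2) * (\<Sum>k\<in>A. (cmod (g k))\<^sup>2)"
proof -
  have "(cmod (\<Sum>k\<in>A. f k * g k))\<^sup>2 \<le> (L2_set (\<lambda>k. cmod (f k)) A * L2_set (\<lambda>k. cmod (g k)) A)\<^sup>2"
    by (intro power_mono cauchy_schwarz_complex norm_ge_zero)
  then show ?thesis by (simp add: power_mult_distrib L2_set_def sum_nonneg)
qed

text \<open>
  The sum is the squared length of column \<open>j\<close> of \<open>y\<^sup>*y\<close>, equivalently the entry \<open>(j, j)\<close> of
  \<open>(y\<^sup>*y)\<^sup>2\<close>. The at most \<open>t\<close> columns that overlap heavily with column \<open>j\<close> contribute at most 1 each.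
  For the others the inner product has at most \<open>t\<close> nonzero terms, so Cauchy--Schwarz bounds its square
  by \<open>t\<close> times the sum of the squares of the terms, and these add up to at most 1 by the bounds on
  the rows and on column \<open>j\<close>.
\<close>

lemma fourth_moment_le:
  assumes E: "few_column_overlaps t n E" and y: "admissible n E y" and j: "j < n"
  shows "(\<Sum>j'<n. (cmod (\<Sum>k<n. cnj (y k j) * y k j'))\<^sup>2) \<le> 2 * real t"
proof -
  define C where "C j' = {k. k < n \<and> (k, j) \<in> E \<and> (k, j') \<in> E}" for j'
  define H where "H = {j'. j' < n \<and> card (C j') > t}"
  have rows: "(\<Sum>j'<n. (cmod (y k j'))\<^sup>2) \<le> 1" if "k < n" for k
    using y that by (simp add: admissible_def)
  have cols: "(\<Sum>k<n. (cmod (y k j'))\<^sup>2) \<le> 1" if "j' < n" for j'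
    using y that by (simp add: admissible_def)
  have term_le: "(cmod (\<Sum>k<n. cnj (y k j) * y k j'))\<^sup>2
      \<le> (if j' \<in> H then 1 else 0) + t * (\<Sum>k<n. (cmod (y k j))\<^sup>2 * (cmod (y k j'))\<^sup>2)"
    if j': "j' < n" for j'
  proof (cases "j' \<in> H")
    case True
    have "(cmod (\<Sum>k<n. cnj (y k j) * y k j'))\<^sup>2
        \<le> (\<Sum>k<n. (cmod (cnj (y k j)))\<^sup>2) * (\<Sum>k<n. (cmod (y k j'))\<^sup>2)"
      by (rule cauchy_schwarz_power2)
    also have "\<dots> \<le> 1 * 1"
      using cols[OF j] cols[OF j'] by (intro mult_mono) (auto intro: sum_nonneg)
    finally show ?thesis using True by (simp add: sum_nonneg add_increasing2)
  next
    case False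
    then have "card (C j') \<le> t" using j' by (simp add: H_def)
    have "(\<Sum>k<n. cnj (y k j) * y k j') = (\<Sum>k\<in>C j'. 1 * (cnj (y k j) * y k j'))"
      using y by (simp, intro sum.mono_neutral_right) (auto simp: C_def admissible_def)
    then have "(cmod (\<Sum>k<n. cnj (y k j) * y k j'))\<^sup>2
        \<le> (\<Sum>k\<in>C j'. (cmod 1)\<^sup>2) * (\<Sum>k\<in>C j'. (cmod (cnj (y k j) * y k j'))\<^sup>2)"
      using cauchy_schwarz_power2[of "\<lambda>_. 1" "\<lambda>k. cnj (y k j) * y k j'" "C j'"] by simp
    also have "\<dots> \<le> t * (\<Sum>k<n. (cmod (y k j))\<^sup>2 * (cmod (y k j'))\<^sup>2)"
      using \<open>card (C j') \<le> t\<close>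
      by (intro mult_mono) (auto simp: C_def norm_mult power_mult_distrib intro!: sum_mono2 sum_nonneg)
    finally show ?thesis using False by simp
  qed
  have "(\<Sum>j'<n. (cmod (\<Sum>k<n. cnj (y k j) * y k j'))\<^sup>2)
      \<le> (\<Sum>j'<n. (if j' \<in> H then 1 else 0) + t * (\<Sum>k<n. (cmod (y k j))\<^sup>2 * (cmod (y k j'))\<^sup>2))"
    by (intro sum_mono term_le) auto
  also have "\<dots> = card H + t * (\<Sum>j'<n. \<Sum>k<n. (cmod (y k j))\<^sup>2 * (cmod (y k j'))\<^sup>2)"
  proof -
    have "H \<inter> {..<n} = H" by (auto simp: H_def)
    then show ?thesis by (simp add: sum.distrib sum_distrib_left sum.If_cases Int_commute)
  qed
  also have "(\<Sum>j'<n. \<Sum>k<n. (cmod (y k j))\<^sup>2 * (cmod (y k j'))\<^sup>2)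
      = (\<Sum>k<n. (cmod (y k j))\<^sup>2 * (\<Sum>j'<n. (cmod (y k j'))\<^sup>2))"
    by (subst sum.swap) (simp add: sum_distrib_left)
  also have "\<dots> \<le> (\<Sum>k<n. (cmod (y k j))\<^sup>2 * 1)"
    using rows by (intro sum_mono mult_left_mono) auto
  also have "\<dots> \<le> 1" using cols[OF j] by simp
  also have "card H \<le> t" using E j by (simp add: few_column_overlaps_def H_def C_def)
  finally show ?thesis by (simp add: mult_left_mono)
qed

text \<open>
  If \<open>g\<close> has the singular vectors of \<open>y\<close> and singular values \<open>h\<^sub>i s\<^sub>i\<close>, then the hypothesis says
  \<open>g\<^sup>*g \<le> c (y\<^sup>*y)\<^sup>2\<close> in the order of positive matrices, and the diagonal entries are compared.
\<close>

lemma column_norm_le_fourth_moment: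
  assumes sd: "singular_decomposition n J s v u y"
    and h: "\<And>i. i \<in> J \<Longrightarrow> (h i)\<^sup>2 \<le> c * (s i)\<^sup>2" and j: "j < n"
  shows "(\<Sum>k<n. (cmod (\<Sum>i\<in>J. of_real (h i * s i) * v i k * cnj (u i j)))\<^sup>2)
    \<le> c * (\<Sum>j'<n. (cmod (\<Sum>k<n. cnj (y k j) * y k j'))\<^sup>2)"
proof -
  have v: "orthonormal n J v" and u: "orthonormal n J u"
    using sd by (auto simp: singular_decomposition_def)
  have fin: "finite J" using v by (simp add: orthonormal_def)
  have gram: "(\<Sum>k<n. cnj (y k j) * y k j') = (\<Sum>i\<in>J. (of_real ((s i)\<^sup>2) * u i j) * cnj (u i j'))"
    if j': "j' < n" for j'
  proof -
    have "(\<Sum>k<n. cnj (y k j) * y k j')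
        = (\<Sum>k<n. \<Sum>i\<in>J. \<Sum>i'\<in>J. of_real (s i * s i') * u i j * cnj (u i' j') * (cnj (v i k) * v i' k))"
      using sd j j' by (auto simp: singular_decomposition_def sum_product mult_ac intro!: sum.cong)
    also have "\<dots> = (\<Sum>i\<in>J. \<Sum>k<n. \<Sum>i'\<in>J. of_real (s i * s i') * u i j * cnj (u i' j') * (cnj (v i k) * v i' k))"
      by (rule sum.swap)
    also have "\<dots> = (\<Sum>i\<in>J. \<Sum>i'\<in>J. of_real (s i * s i') * u i j * cnj (u i' j') * (\<Sum>k<n. cnj (v i k) * v i' k))"
      by (intro sum.cong refl, subst sum.swap) (simp add: sum_distrib_left)
    also have "\<dots> = (\<Sum>i\<in>J. \<Sum>i'\<in>J. if i' = i then of_real (s i * s i') * u i j * cnj (u i' j') else 0)"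
      using v by (intro sum.cong refl) (auto simp: orthonormal_def)
    finally show ?thesis using fin by (simp add: power2_eq_square)
  qed
  have "(\<Sum>k<n. (cmod (\<Sum>i\<in>J. of_real (h i * s i) * v i k * cnj (u i j)))\<^sup>2)
      = (\<Sum>k<n. (cmod (\<Sum>i\<in>J. (of_real (h i * s i) * cnj (u i j)) * v i k))\<^sup>2)"
    by (simp add: mult_ac)
  also have "\<dots> = (\<Sum>i\<in>J. (h i)\<^sup>2 * (s i)\<^sup>2 * (cmod (u i j))\<^sup>2)"
    by (subst orthonormal_pythagoras[OF v]) (simp add: norm_mult power_mult_distrib)
  also have "\<dots> \<le> (\<Sum>i\<in>J. (c * (s i)\<^sup>2) * (s i)\<^sup>2 * (cmod (u i j))\<^sup>2)"
    by (intro sum_mono mult_right_mono h) auto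
  also have "\<dots> = c * (\<Sum>i\<in>J. (cmod (of_real ((s i)\<^sup>2) * u i j))\<^sup>2)"
    by (simp add: sum_distrib_left norm_mult norm_power power_mult_distrib mult_ac)
  also have "(\<Sum>i\<in>J. (cmod (of_real ((s i)\<^sup>2) * u i j))\<^sup>2)
      = (\<Sum>j'<n. (cmod (\<Sum>i\<in>J. (of_real ((s i)\<^sup>2) * u i j) * cnj (u i j')))\<^sup>2)"
    by (rule orthonormal_pythagoras[OF orthonormal_cnj[OF u], symmetric])
  also have "\<dots> = (\<Sum>j'<n. (cmod (\<Sum>k<n. cnj (y k j) * y k j'))\<^sup>2)"
    by (intro sum.cong refl) (simp add: gram)
  finally show ?thesis .
qed

text \<open>
  The smooth splitting \<open>x = M x / (M + x\<^sup>2) + x\<^sup>3 / (M + x\<^sup>2)\<close> of a singular value into a bounded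
  part and a part dominated by \<open>x\<^sup>2\<close>. Both bounds are the inequality \<open>2 r x \<le> r\<^sup>2 + x\<^sup>2\<close>, where
  \<open>r\<^sup>2 = M\<close>.
\<close>

lemma singular_value_truncation:
  fixes x M :: real
  assumes M: "M > 0" and x: "x \<ge> 0"
  defines "h \<equiv> x\<^sup>2 / (M + x\<^sup>2)"
  shows "h\<^sup>2 \<le> 1 / (4 * M) * x\<^sup>2" and "\<bar>(1 - h) * x\<bar> \<le> sqrt M / 2"
proof -
  define r where "r = sqrt M"
  have r: "M = r\<^sup>2" "r > 0" using M by (auto simp: r_def)
  define D where "D = r\<^sup>2 + x\<^sup>2"
  have D: "D > 0" using r by (simp add: D_def add_pos_nonneg)
  have hD: "h = x\<^sup>2 / D" by (simp add: h_def D_def r(1))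
  have amgm: "2 * r * x \<le> D"
    using sum_squares_bound[of r x] by (simp add: D_def)
  have "(1 - h) * D = r\<^sup>2" using D by (simp add: hD left_diff_distrib) (simp add: D_def)
  then have "1 - h = r\<^sup>2 / D" using D by (simp add: eq_divide_eq)
  then have "(1 - h) * x = r * (r * x / D)" by (simp add: power2_eq_square)
  moreover have "r * x / D \<le> 1 / 2" using amgm D by (simp add: field_simps)
  then have "r * (r * x / D) \<le> r * (1 / 2)" using r by (intro mult_left_mono) auto
  moreover have "r * (r * x / D) \<ge> 0" using r x D by simp
  ultimately show "\<bar>(1 - h) * x\<bar> \<le> sqrt M / 2" unfolding r_def[symmetric] by linarith
  have "x / D \<le> 1 / (2 * r)" using amgm r D by (simp add: field_simps)
  then have "x * (x / D) \<le> x * (1 / (2 * r))" using x by (intro mult_left_mono) auto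
  then have "h \<le> x / (2 * r)" by (simp add: hD power2_eq_square)
  moreover have "h \<ge> 0" using D by (simp add: hD)
  ultimately have "h\<^sup>2 \<le> (x / (2 * r))\<^sup>2" by (intro power_mono)
  then show "h\<^sup>2 \<le> 1 / (4 * M) * x\<^sup>2" by (simp add: r(1) power_divide power_mult_distrib)
qed

text \<open>
  Split the singular values of \<open>y\<close> as above with \<open>M = 2 t\<close>. The part \<open>f\<close> is bounded in operator norm
  but need not live on \<open>E\<close>. The rows and columns of the other part have length at most \<open>1/2\<close> by the
  fourth moment bound for \<open>y\<close> and for its adjoint, and this persists when it is cut down to \<open>E\<close>.
\<close>

lemma admissible_split:
  assumes t: "t > 0" and E: "few_column_overlaps t n E" "few_column_overlaps t n (E\<inverse>)"
    and y: "admissible n E y"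
  obtains f g where "op_bounded n (sqrt (2 * real t) / 2) f" "admissible n E (\<lambda>k j. 2 * g k j)"
    "\<And>k j. k < n \<Longrightarrow> j < n \<Longrightarrow> (k, j) \<in> E \<Longrightarrow> y k j = f k j + g k j"
proof -
  define M where "M = 2 * real t"
  have M: "M > 0" using t by (simp add: M_def)
  obtain J :: "nat set" and s v u where
    "singular_decomposition n J s v u (\<lambda>k j. mat n n (\<lambda>(k, j). y k j) $$ (k, j))"
    using ex_singular_decomposition[of "mat n n (\<lambda>(k, j). y k j)" n] by auto
  then have sd: "singular_decomposition n J s v u y"
    by (simp add: singular_decomposition_def)
  have v: "orthonormal n J v" and u: "orthonormal n J u" and s: "\<And>i. i \<in> J \<Longrightarrow> s i > 0"
    using sd by (auto simp: singular_decomposition_def)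
  define h where "h i = (s i)\<^sup>2 / (M + (s i)\<^sup>2)" for i
  have h: "(h i)\<^sup>2 \<le> 1 / (4 * M) * (s i)\<^sup>2" "\<bar>(1 - h i) * s i\<bar> \<le> sqrt M / 2" if "i \<in> J" for i
    using singular_value_truncation[OF M, of "s i"] s[OF that] by (auto simp: h_def)
  define f where "f k j = (\<Sum>i\<in>J. of_real ((1 - h i) * s i) * v i k * cnj (u i j))" for k j
  define g where "g k j = (\<Sum>i\<in>J. of_real (h i * s i) * v i k * cnj (u i j))" for k j
  define g' where "g' k j = (if (k, j) \<in> E then g k j else 0)" for k j
  \<comment> \<open>The factor \<open>1 / (4 M)\<close> from the splitting times the moment bound \<open>2 t = M\<close> gives \<open>1/4\<close>.\<close>
  have quarter: "(\<Sum>l<n. (cmod (2 * z l))\<^sup>2) \<le> 1"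
    if "(\<Sum>l<n. (cmod (w l))\<^sup>2) \<le> 1 / (4 * M) * B" "B \<le> 2 * real t" "\<And>l. cmod (z l) \<le> cmod (w l)"
    for z w and B :: real
  proof -
    have "(\<Sum>l<n. (cmod (2 * z l))\<^sup>2) = 4 * (\<Sum>l<n. (cmod (z l))\<^sup>2)"
      by (simp add: norm_mult power_mult_distrib sum_distrib_left)
    also have "(\<Sum>l<n. (cmod (z l))\<^sup>2) \<le> (\<Sum>l<n. (cmod (w l))\<^sup>2)"
      by (intro sum_mono power_mono that) auto
    also note that(1)
    also have "1 / (4 * M) * B \<le> 1 / (4 * M) * (2 * real t)"
      using M that(2) by (intro mult_left_mono) auto
    also have "\<dots> = 1 / 4" using M by (simp add: M_def)
    finally show ?thesis by simp
  qed
  show thesis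
  proof
    show "op_bounded n (sqrt (2 * real t) / 2) f"
      unfolding f_def using op_bounded_orthonormal_sum[OF v orthonormal_cnj[OF u] h(2)] M
      by (simp add: M_def)
    show "y k j = f k j + g' k j" if "k < n" "j < n" "(k, j) \<in> E" for k j
    proof -
      have "y k j = (\<Sum>i\<in>J. of_real (s i) * v i k * cnj (u i j))"
        using sd that by (simp add: singular_decomposition_def)
      also have "\<dots> = f k j + g k j"
        by (simp add: f_def g_def sum.distrib[symmetric] algebra_simps)
      finally show ?thesis using that by (simp add: g'_def)
    qed
    show "admissible n E (\<lambda>k j. 2 * g' k j)"
      unfolding admissible_def
    proof (intro conjI allI impI)
      show "(\<Sum>k<n. (cmod (2 * g' k j))\<^sup>2) \<le> 1" if j: "j < n" for j
        by (rule quarter[where w = "\<lambda>k. g k j", OF _ fourth_moment_le[OF E(1) y j]])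
          (use column_norm_le_fourth_moment[OF sd h(1) j] in \<open>auto simp: g_def g'_def\<close>)
      show "(\<Sum>j<n. (cmod (2 * g' k j))\<^sup>2) \<le> 1" if k: "k < n" for k
      proof (rule quarter[where w = "\<lambda>j. cnj (g k j)",
            OF _ fourth_moment_le[OF E(2) admissible_adjoint[OF y] k]])
        show "(\<Sum>j<n. (cmod (cnj (g k j)))\<^sup>2)
            \<le> 1 / (4 * M) * (\<Sum>k'<n. (cmod (\<Sum>j<n. cnj (cnj (y k j)) * cnj (y k' j)))\<^sup>2)"
          using column_norm_le_fourth_moment[OF singular_decomposition_adjoint[OF sd] h(1) k]
          by (simp add: g_def mult_ac)
      qed (auto simp: g'_def)
    qed (simp add: g'_def)
  qed
qed

text \<open>
  Let \<open>S\<close> be the supremum of the left-hand side over all admissible \<open>y\<close>. Splitting \<open>y\<close> bounds each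
  value by a multiple of the trace norm plus \<open>S / 2\<close>, because the part in \<open>S / 2\<close> is half an admissible
  matrix. Hence \<open>S\<close> itself is at most twice that multiple; finiteness of \<open>S\<close> is needed to absorb \<open>S / 2\<close>.
\<close>

lemma pairing_le_sparse:
  assumes t: "t > 0" and E: "few_column_overlaps t n E" "few_column_overlaps t n (E\<inverse>)"
    and x: "\<And>k j. (k, j) \<notin> E \<Longrightarrow> x k j = 0" and y: "admissible n E y"
  shows "cmod (pairing n x y) \<le> sqrt (2 * real t) * trace_norm (mat n n (\<lambda>(k, j). x k j))"
proof -
  define N where "N = trace_norm (mat n n (\<lambda>(k, j). x k j))"
  define V where "V = (\<lambda>y. cmod (pairing n x y)) ` {y. admissible n E y}"
  have "cmod (pairing n x z) \<le> (\<Sum>k<n. \<Sum>j<n. cmod (x k j))" if z: "admissible n E z" for z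
  proof -
    have z1: "cmod (z k j) \<le> 1" if "k < n" "j < n" for k j
    proof -
      have "(cmod (z k j))\<^sup>2 \<le> (\<Sum>j<n. (cmod (z k j))\<^sup>2)"
        using that by (intro member_le_sum) auto
      also have "\<dots> \<le> 1" using z that by (simp add: admissible_def)
      finally show ?thesis by (simp add: abs_square_le_1)
    qed
    have "cmod (pairing n x z) \<le> (\<Sum>k<n. \<Sum>j<n. cmod (x k j * z k j))"
      unfolding pairing_def by (intro order.trans[OF norm_sum] sum_mono norm_sum)
    also have "\<dots> \<le> (\<Sum>k<n. \<Sum>j<n. cmod (x k j))"
      by (intro sum_mono) (auto simp: norm_mult intro!: mult_left_le z1)
    finally show ?thesis .
  qed
  then have bdd: "bdd_above V" by (auto simp: V_def bdd_above_def)
  have step: "cmod (pairing n x z) \<le> sqrt (2 * real t) / 2 * N + Sup V / 2" if z_adm: "admissible n E z" for z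
  proof -
    obtain f g where f: "op_bounded n (sqrt (2 * real t) / 2) f"
      and g: "admissible n E (\<lambda>k j. 2 * g k j)"
      and z: "\<And>k j. k < n \<Longrightarrow> j < n \<Longrightarrow> (k, j) \<in> E \<Longrightarrow> z k j = f k j + g k j"
      using admissible_split[OF t E z_adm] by metis
    have "x k j * z k j = x k j * f k j + x k j * (2 * g k j) / 2" if "k < n" "j < n" for k j
      using x[of k j] z[OF that] by (cases "(k, j) \<in> E") (auto simp: algebra_simps)
    then have "pairing n x z = pairing n x f + pairing n x (\<lambda>k j. 2 * g k j) / 2"
      by (simp add: pairing_def sum.distrib sum_divide_distrib)
    then have "cmod (pairing n x z) \<le> cmod (pairing n x f) + cmod (pairing n x (\<lambda>k j. 2 * g k j)) / 2"
      by (metis norm_triangle_ineq norm_divide norm_numeral)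
    also have "pairing n x f = pairing n (\<lambda>k j. mat n n (\<lambda>(k, j). x k j) $$ (k, j)) f"
      by (simp add: pairing_def)
    also have "cmod \<dots> \<le> sqrt (2 * real t) / 2 * N"
      unfolding N_def by (rule pairing_le_trace_norm[OF _ f]) simp
    also have "cmod (pairing n x (\<lambda>k j. 2 * g k j)) \<le> Sup V"
      using g by (intro cSup_upper bdd) (auto simp: V_def)
    finally show ?thesis by simp
  qed
  have "Sup V \<le> sqrt (2 * real t) / 2 * N + Sup V / 2"
    using y step by (intro cSup_least) (auto simp: V_def)
  moreover have "cmod (pairing n x y) \<le> Sup V"
    using y by (intro cSup_upper bdd) (auto simp: V_def)
  ultimately show ?thesis by (simp add: N_def)
qed

text \<open>
  Test the multiplied matrix against a norming contraction \<open>z\<close>, and move the multipliers and the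
  restriction to \<open>E\<close> from the matrix to \<open>z\<close>. This destroys the operator norm bound, but rows and
  columns of \<open>z\<close> have length at most 1 and can only get shorter, so the result is admissible.
\<close>

theorem unconditional_units_of_few_overlaps:
  assumes t: "t > 0" and sub: "E \<subseteq> {..<n} \<times> {..<n}"
    and E: "few_column_overlaps t n E" "few_column_overlaps t n (E\<inverse>)"
  shows "unconditional_units (sqrt (2 * real t)) n E"
  unfolding unconditional_units_def
proof (intro allI impI)
  fix x \<alpha> :: "nat \<times> nat \<Rightarrow> complex"
  assume \<alpha>: "\<forall>p\<in>E. cmod (\<alpha> p) \<le> 1"
  let ?x = "\<lambda>k j. if (k, j) \<in> E then x (k, j) else 0"
  let ?A = "unit_combination n E (\<lambda>p. \<alpha> p * x p)"
  have A: "?A = mat n n (\<lambda>p. if p \<in> E then \<alpha> p * x p else 0)"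
    by (rule unit_combination_eq_mat[OF sub])
  have X: "unit_combination n E x = mat n n (\<lambda>(k, j). ?x k j)"
    unfolding unit_combination_eq_mat[OF sub] by (intro eq_matI) auto
  obtain z where z: "op_bounded n 1 z" "pairing n (\<lambda>k j. ?A $$ (k, j)) z = of_real (trace_norm ?A)"
    using trace_norm_attained[of ?A n] by (auto simp: A)
  define y where "y k j = (if (k, j) \<in> E then \<alpha> (k, j) * z k j else 0)" for k j
  have y_le: "(cmod (y k j))\<^sup>2 \<le> (cmod (z k j))\<^sup>2" for k j
    using \<alpha> by (auto simp: y_def norm_mult intro!: power_mono mult_left_le_one_le)
  have y: "admissible n E y"
    unfolding admissible_def
  proof (intro conjI allI impI)
    show "(\<Sum>j<n. (cmod (y k j))\<^sup>2) \<le> 1" if "k < n" for k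
      by (rule order.trans[OF sum_mono[OF y_le] op_bounded_row[OF z(1) that]])
    show "(\<Sum>k<n. (cmod (y k j))\<^sup>2) \<le> 1" if "j < n" for j
      by (rule order.trans[OF sum_mono[OF y_le] op_bounded_row[OF op_bounded_transpose[OF z(1)] that]])
  qed (simp add: y_def)
  have "pairing n (\<lambda>k j. ?A $$ (k, j)) z = pairing n ?x y"
    unfolding A pairing_def by (intro sum.cong refl) (simp add: y_def)
  then have "of_real (trace_norm ?A) = pairing n ?x y" by (simp only: z(2))
  then have "trace_norm ?A \<le> cmod (pairing n ?x y)"
    by (metis abs_ge_self norm_of_real)
  also have "\<dots> \<le> sqrt (2 * real t) * trace_norm (mat n n (\<lambda>(k, j). ?x k j))"
    by (rule pairing_le_sparse[OF t E _ y]) simp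
  finally show "trace_norm ?A \<le> sqrt (2 * real t) * trace_norm (unit_combination n E x)"
    by (simp only: X)
qed

section \<open>Large patterns from affine planes\<close>

definition rectangle_free :: "('a \<times> 'b) set \<Rightarrow> bool" where
  "rectangle_free R \<longleftrightarrow> (\<forall>i i' k k'. (i, k) \<in> R \<longrightarrow> (i, k') \<in> R \<longrightarrow> (i', k) \<in> R \<longrightarrow> (i', k') \<in> R \<longrightarrow>
     i = i' \<or> k = k')"

lemma rectangle_free_converse: "rectangle_free R \<Longrightarrow> rectangle_free (R\<inverse>)"
  unfolding rectangle_free_def by blast

text \<open>
  The field with \<open>q\<close> elements inside an algebraically closed field of positive characteristic: the
  polynomial \<open>X\<^sup>q - X\<close> has derivative \<open>-1\<close>, hence \<open>q\<close> distinct roots.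
\<close>

lemma card_frobenius_fixed_points:
  fixes q :: nat
  assumes p: "Factorial_Ring.prime CHAR('a :: alg_closed_field)" and q: "q = CHAR('a) ^ j" and j: "j > 0"
  shows "card {x :: 'a. x ^ q = x} = q"
proof -
  define P :: "'a poly" where "P = Polynomial.monom 1 q - Polynomial.monom 1 1"
  have q1: "q > 1"
    using p j unfolding q by (metis one_less_power prime_gt_1_nat)
  have char_q: "of_nat q = (0 :: 'a)"
    using j by (simp add: q)
  have deg: "Polynomial.degree P = q"
    using q1 unfolding P_def 
    by (subst diff_conv_add_uminus, subst Polynomial.degree_add_eq_left) (auto simp: Polynomial.degree_monom_eq)
  have "P \<noteq> 0" using deg q1 by auto
  have pd: "pderiv P = - 1"
    using char_q by (simp add: P_def pderiv_diff pderiv_monom)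
  from alg_closed_imp_factorization[OF \<open>P \<noteq> 0\<close>] obtain A b where
    A: "size A = q" "P = Polynomial.smult b (\<Prod>x\<in>#A. [:-x, 1:])"
    unfolding deg by blast
  have "b \<noteq> 0" using A(2) \<open>P \<noteq> 0\<close> by (metis Polynomial.smult_0_left)
  have "count A a \<le> 1" for a
  proof (rule ccontr)
    assume "\<not> ?thesis"
    then have "replicate_mset 2 a \<subseteq># A" by (subst count_le_replicate_mset_subset_eq[symmetric]) simp
    then obtain B where "A = replicate_mset 2 a + B" by (metis subset_mset.add_diff_inverse)
    then have "\<exists>R. P = [:-a, 1:] * ([:-a, 1:] * R)"
      by (intro exI[of _ "Polynomial.smult b (\<Prod>x\<in>#B. [:-x, 1:])"], subst A(2))
        (simp add: numeral_2_eq_2)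
    then obtain R where "P = [:-a, 1:] * ([:-a, 1:] * R)" ..
    then have "poly (pderiv P) a = 0" by (simp only: pderiv_mult poly_add poly_mult) simp
    then show False by (simp add: pd)
  qed
  then have "card (set_mset A) = size A"
    by (metis (no_types, lifting) One_nat_def Suc_leI antisym card_eq_sum count_greater_zero_iff
      size_multiset_overloaded_eq sum.cong)
  moreover have "poly P x = 0 \<longleftrightarrow> x \<in># A" for x
    by (subst A(2)) (use \<open>b \<noteq> 0\<close> in \<open>auto simp: poly_prod_mset prod_mset_zero_iff image_iff\<close>)
  then have "set_mset A = {x. x ^ q = x}"
    by (auto simp: P_def poly_monom)
  ultimately show ?thesis using A(1) by simp
qed

lemma CHAR_bit: "CHAR(bit) = 2"
  by (rule CHAR_eq_posI) (auto simp: less_2_cases_iff)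

text \<open>
  The incidence relation between the \<open>q\<^sup>2\<close> points \<open>(a, b)\<close> and the \<open>q\<^sup>2\<close> non-vertical lines
  \<open>y = m x + c\<close> of the affine plane over the field with \<open>q\<close> elements: it has \<open>q\<^sup>3\<close> incidences, and two
  distinct points lie on at most one common line.
\<close>

lemma affine_plane_incidence:
  fixes q :: nat
  assumes q: "q = 2 ^ j" and j: "j > 0"
  shows "\<exists>R \<subseteq> {..<q\<^sup>2} \<times> {..<q\<^sup>2}. card R = q ^ 3 \<and> rectangle_free R"
proof -
  define F where "F = {x :: bit alg_closure. x ^ q = x}"
  have char: "CHAR(bit alg_closure) = 2" by (simp add: CHAR_bit)
  have card_F: "card F = q"
    unfolding F_def using card_frobenius_fixed_points[where 'a = "bit alg_closure", of q j] q j char by simp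
  have "q > 0" by (simp add: q)
  have fin: "finite F" using card_F \<open>q > 0\<close> by (metis card_ge_0_finite)
  have add: "x + y \<in> F" if "x \<in> F" "y \<in> F" for x y
    using that freshmans_dream'[where 'a = "bit alg_closure", of q j x y] q char by (simp add: F_def)
  have mult: "x * y \<in> F" if "x \<in> F" "y \<in> F" for x y
    using that by (simp add: F_def power_mult_distrib)
  obtain h where h: "bij_betw h (F \<times> F) {..<q\<^sup>2}"
    using finite_same_card_bij[of "F \<times> F" "{..<q\<^sup>2}"] fin
    by (auto simp: card_cartesian_product card_F power2_eq_square)
  \<comment> \<open>A triple \<open>(a, m, c)\<close> encodes the incidence of \<open>(a, m a + c)\<close> with the line of slope \<open>m\<close> and intercept \<open>c\<close>.\<close>
  define S where "S = F \<times> F \<times> F"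
  define g where "g = (\<lambda>(a, m, c). (h (a, m * a + c), h (m, c)))"
  have inj: "h x = h y \<longleftrightarrow> x = y" if "x \<in> F \<times> F" "y \<in> F \<times> F" for x y
    using h that by (auto simp: bij_betw_def inj_on_def)
  have inj_g: "inj_on g S"
    by (auto simp: inj_on_def g_def S_def inj add mult)
  have meet: "a = a' \<or> m = m'" if "m * a + c = m' * a + c'" "m * a' + c = m' * a' + c'"
    for a a' m m' c c' :: "bit alg_closure"
  proof -
    have "(m - m') * (a - a') = (m * a + c - (m' * a + c')) - (m * a' + c - (m' * a' + c'))"
      by (simp add: algebra_simps)
    then have "(m - m') * (a - a') = 0" using that by simp
    then show ?thesis by auto
  qed
  show ?thesis
    unfolding rectangle_free_def
  proof (intro exI[of _ "g ` S"] conjI allI impI)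
    show "g ` S \<subseteq> {..<q\<^sup>2} \<times> {..<q\<^sup>2}"
      using h add mult by (auto simp: g_def S_def bij_betw_def)
    show "card (g ` S) = q ^ 3"
      unfolding card_image[OF inj_g] by (simp add: S_def card_cartesian_product card_F power3_eq_cube)
  next
    fix i i' k k'
    assume R: "(i, k) \<in> g ` S" "(i, k') \<in> g ` S" "(i', k) \<in> g ` S" "(i', k') \<in> g ` S"
    have incident: "b = m * a + c"
      if "a \<in> F" "b \<in> F" "m \<in> F" "c \<in> F" "(h (a, b), h (m, c)) \<in> g ` S" for a b m c
      using that by (auto simp: g_def S_def inj add mult)
    obtain a m c where 1: "a \<in> F" "m \<in> F" "c \<in> F" "i = h (a, m * a + c)" "k = h (m, c)"
      using R(1) by (auto simp: g_def S_def)
    obtain a' m' c' where 2: "a' \<in> F" "m' \<in> F" "c' \<in> F" "i' = h (a', m' * a' + c')" "k' = h (m', c')"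
      using R(4) by (auto simp: g_def S_def)
    have eq: "m * a + c = m' * a + c'" "m' * a' + c' = m * a' + c"
      using R(2,3) incident 1 2 add mult by auto
    then have "a = a' \<or> m = m'" using meet by metis
    with eq show "i = i' \<or> k = k'" using 1 2 by auto
  qed
qed

text \<open>
  Every point of the pattern \<open>R\<close> on \<open>{..<N}\<close> is replaced by a whole residue class, which spreads copies
  of each incidence over an index set of arbitrary size \<open>n\<close>.
\<close>

definition residue_blow_up :: "nat \<Rightarrow> nat \<Rightarrow> (nat \<times> nat) set \<Rightarrow> (nat \<times> nat) set" where
  "residue_blow_up n N R = {(i, j). i < n \<and> j < n \<and> (i mod N, j mod N) \<in> R}"

lemma residue_blow_up_converse: "(residue_blow_up n N R)\<inverse> = residue_blow_up n N (R\<inverse>)"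
  by (auto simp: residue_blow_up_def)

lemma card_residue_class_le:
  fixes n N t r :: nat
  assumes "n \<le> t * N"
  shows "card {k. k < n \<and> k mod N = r} \<le> t"
proof -
  have "inj_on (\<lambda>k. k div N) {k. k < n \<and> k mod N = r}"
    by (rule inj_onI) (metis (mono_tags, lifting) div_mult_mod_eq mem_Collect_eq)
  moreover have "(\<lambda>k. k div N) ` {k. k < n \<and> k mod N = r} \<subseteq> {..<t}"
    using assms by (auto simp: less_mult_imp_div_less)
  ultimately have "card {k. k < n \<and> k mod N = r} \<le> card {..<t}"
    by (rule card_inj_on_le) simp
  then show ?thesis by simp
qed

text \<open>
  Residue classes have at most \<open>t\<close> members. Columns in the same class can overlap a lot, but there are
  at most \<open>t\<close> of them; columns in different classes overlap in rows of a single class.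
\<close>

lemma few_column_overlaps_blow_up:
  assumes R: "rectangle_free R" and n: "n \<le> t * N"
  shows "few_column_overlaps t n (residue_blow_up n N R)"
  unfolding few_column_overlaps_def
proof (intro allI impI)
  let ?E = "residue_blow_up n N R"
  fix j assume j: "j < n"
  have "card {k. k < n \<and> (k, j) \<in> ?E \<and> (k, j') \<in> ?E} \<le> t" if "j' mod N \<noteq> j mod N" for j'
  proof (cases "{k. k < n \<and> (k, j) \<in> ?E \<and> (k, j') \<in> ?E} = {}")
    case False
    then obtain l where l: "(l, j) \<in> ?E" "(l, j') \<in> ?E" by blast
    have "{k. k < n \<and> (k, j) \<in> ?E \<and> (k, j') \<in> ?E} \<subseteq> {k. k < n \<and> k mod N = l mod N}"
      using l R that unfolding rectangle_free_def residue_blow_up_def by blast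
    then have "card {k. k < n \<and> (k, j) \<in> ?E \<and> (k, j') \<in> ?E} \<le> card {k. k < n \<and> k mod N = l mod N}"
      by (intro card_mono) auto
    also have "\<dots> \<le> t" by (rule card_residue_class_le[OF n])
    finally show ?thesis .
  qed (simp only: card.empty)
  then have "{j'. j' < n \<and> card {k. k < n \<and> (k, j) \<in> ?E \<and> (k, j') \<in> ?E} > t}
      \<subseteq> {j'. j' < n \<and> j' mod N = j mod N}"
    using linorder_not_le by blast
  then have "card {j'. j' < n \<and> card {k. k < n \<and> (k, j) \<in> ?E \<and> (k, j') \<in> ?E} > t}
      \<le> card {j'. j' < n \<and> j' mod N = j mod N}"
    by (intro card_mono) auto
  also have "\<dots> \<le> t" by (rule card_residue_class_le[OF n])
  finally show "card {j'. j' < n \<and> card {k. k < n \<and> (k, j) \<in> ?E \<and> (k, j') \<in> ?E} > t} \<le> t" .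
qed

lemma card_residue_blow_up_ge:
  assumes R: "R \<subseteq> {..<N} \<times> {..<N}" and m: "m * N \<le> n"
  shows "m\<^sup>2 * card R \<le> card (residue_blow_up n N R)"
proof -
  define g where "g = (\<lambda>((i, j), (a, b)). (i + a * N, j + b * N :: nat))"
  have "inj_on g (R \<times> ({..<m} \<times> {..<m}))"
  proof (rule inj_onI)
    have uniq: "i = i' \<and> a = a'" if "i + a * N = i' + a' * N" "i < N" "i' < N" for i a i' a' :: nat
    proof -
      have "(i + a * N) mod N = (i' + a' * N) mod N" by (simp only: that(1))
      then have "i = i'" using that(2,3) by simp
      then show ?thesis using that by simp
    qed
    fix x y assume "x \<in> R \<times> ({..<m} \<times> {..<m})" "y \<in> R \<times> ({..<m} \<times> {..<m})" "g x = g y"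
    then show "x = y" using R by (auto simp: g_def dest!: uniq)
  qed
  moreover have "g ` (R \<times> ({..<m} \<times> {..<m})) \<subseteq> residue_blow_up n N R"
  proof -
    have "i + a * N < n" if "i < N" "a < m" for i a
    proof -
      have "i + a * N < (a + 1) * N" using that by simp
      also have "\<dots> \<le> m * N" using that by (intro mult_right_mono) auto
      finally show ?thesis using m by simp
    qed
    then show ?thesis using R by (auto simp: g_def residue_blow_up_def)
  qed
  moreover have "finite (residue_blow_up n N R)"
    by (rule finite_subset[of _ "{..<n} \<times> {..<n}"]) (auto simp: residue_blow_up_def)
  ultimately have "card (R \<times> ({..<m} \<times> {..<m})) \<le> card (residue_blow_up n N R)"
    by (metis card_inj_on_le)
  then show ?thesis by (simp add: card_cartesian_product power2_eq_square mult.commute)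
qed

lemma card_matrix_units:
  assumes "E \<subseteq> {..<n} \<times> {..<n}"
  shows "card {matrix_unit n i j | i j. (i, j) \<in> E} = card E"
proof -
  have "inj_on (\<lambda>(i, j). matrix_unit n i j) E"
  proof (rule inj_onI, clarify)
    fix i j i' j' assume E: "(i, j) \<in> E" "(i', j') \<in> E" and "matrix_unit n i j = matrix_unit n i' j'"
    then have "matrix_unit n i j $$ (i, j) = matrix_unit n i' j' $$ (i, j)" by simp
    then show "i = i' \<and> j = j'" using E assms by (auto simp: matrix_unit_def split: if_splits)
  qed
  moreover have "{matrix_unit n i j | i j. (i, j) \<in> E} = (\<lambda>(i, j). matrix_unit n i j) ` E" by auto
  ultimately show ?thesis by (simp add: card_image)
qed

lemma powr_three_halves_le:
  assumes "n ^ 3 \<le> (k :: nat)\<^sup>2"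
  shows "real n powr (3/2) \<le> real k"
proof -
  have "real (n ^ 3) \<le> real (k\<^sup>2)" using assms by (simp only: of_nat_le_iff)
  then have *: "real n ^ 3 \<le> (real k)\<^sup>2" by simp
  have "real n powr (3/2) = (real n powr 3) powr (1/2)" by (subst powr_powr) simp
  also have "\<dots> = sqrt (real n ^ 3)" by (simp add: powr_half_sqrt)
  also have "\<dots> \<le> sqrt ((real k)\<^sup>2)" using * by (rule real_sqrt_le_mono)
  finally show ?thesis by simp
qed

text \<open>
  Blow up an affine plane with \<open>N = q\<^sup>2\<close> points to size \<open>n\<close>, where \<open>q\<close> is the power of 2 with
  \<open>4 N \<le> n < 16 N\<close>. An \<open>m\<close>-fold blow-up multiplies the number of indices by \<open>m\<close> and the size of the pattern
  by \<open>m\<^sup>2\<close>, which beats \<open>m\<^sup>3\<^sup>/\<^sup>2\<close>: this surplus compensates for rounding \<open>n\<close> down to a multiple of \<open>N\<close>,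
  and the lower bound \<open>4 N\<close> ensures that the surplus is large enough. The upper bound \<open>16 N\<close> keeps
  the residue classes, hence the unconditionality constant, bounded.
\<close>

lemma ex_large_pattern:
  fixes n :: nat
  assumes n: "n \<ge> 16"
  shows "\<exists>E \<subseteq> {..<n} \<times> {..<n}. few_column_overlaps 16 n E \<and> few_column_overlaps 16 n (E\<inverse>) \<and>
    real n powr (3/2) \<le> real (card E)"
proof -
  obtain e where e: "4 ^ e \<le> n" "n < 4 ^ (e + 1)"
    using ex_power_ivl1[of 4 n] n by auto
  have "e \<ge> 2"
  proof (rule ccontr)
    assume "\<not> e \<ge> 2"
    then have "4 ^ (e + 1) \<le> (4 :: nat) ^ 2" by (intro power_increasing) auto
    then show False using e n by simp
  qed
  then obtain j where j: "e = j + 1" "j > 0" by (cases e) auto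
  define q :: nat where "q = 2 ^ j"
  define N where "N = q\<^sup>2"
  have N: "N = 4 ^ j" by (simp add: N_def q_def power_mult[symmetric] power2_eq_square flip: power_mult_distrib)
  have N_pos: "N > 0" by (simp add: N)
  have n4: "4 * N \<le> n" and n16: "n \<le> 16 * N" using e by (simp_all add: N j)
  obtain R where R: "R \<subseteq> {..<N} \<times> {..<N}" "card R = q ^ 3" "rectangle_free R"
    using affine_plane_incidence[OF q_def j(2)] unfolding N_def by blast
  define m where "m = n div N"
  have m: "m \<ge> 4" using n4 N_pos by (simp add: m_def less_eq_div_iff_mult_less_eq)
  have n_less: "n \<le> (m + 1) * N"
    using div_mult_mod_eq[of n N] mod_less_divisor[OF N_pos, of n]
    unfolding m_def add_mult_distrib by linarith
  have "(m + 1) ^ 3 \<le> m ^ 4"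
  proof -
    have "4 * m \<le> m * m" "4 * (m * m) \<le> m * (m * m)" "4 * (m * (m * m)) \<le> m * (m * (m * m))"
      using m by (simp_all only: mult_le_mono1)
    moreover have "(m + 1) ^ 3 = m * (m * m) + 3 * (m * m) + 3 * m + 1" "m ^ 4 = m * (m * (m * m))"
      by (simp_all add: power3_eq_cube power4_eq_xxxx algebra_simps)
    ultimately show ?thesis using m by linarith
  qed
  have "n ^ 3 \<le> ((m + 1) * N) ^ 3" using n_less by (rule power_mono) simp
  also have "\<dots> = (m + 1) ^ 3 * N ^ 3" by (rule power_mult_distrib)
  also have "\<dots> \<le> m ^ 4 * N ^ 3" using \<open>(m + 1) ^ 3 \<le> m ^ 4\<close> by simp
  also have "\<dots> = (m\<^sup>2 * q ^ 3)\<^sup>2" by (simp add: N_def power_mult_distrib flip: power_mult)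
  finally have "n ^ 3 \<le> (m\<^sup>2 * q ^ 3)\<^sup>2" .
  then have "real n powr (3/2) \<le> real (m\<^sup>2 * q ^ 3)" by (rule powr_three_halves_le)
  also have "m\<^sup>2 * q ^ 3 \<le> card (residue_blow_up n N R)"
    using card_residue_blow_up_ge[OF R(1), of m n] by (simp add: m_def R(2) div_times_less_eq_dividend)
  finally have "real n powr (3/2) \<le> real (card (residue_blow_up n N R))" by simp
  moreover have "residue_blow_up n N R \<subseteq> {..<n} \<times> {..<n}" by (auto simp: residue_blow_up_def)
  moreover have "few_column_overlaps 16 n ((residue_blow_up n N R)\<inverse>)"
    unfolding residue_blow_up_converse
    by (rule few_column_overlaps_blow_up[OF rectangle_free_converse[OF R(3)] n16])
  ultimately show ?thesis
    using few_column_overlaps_blow_up[OF R(3) n16] by (intro exI conjI)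
qed

lemma few_column_overlaps_small:
  assumes "n \<le> t"
  shows "few_column_overlaps t n E"
  unfolding few_column_overlaps_def
proof (intro allI impI)
  fix j
  have "card {j'. j' < n \<and> card {k. k < n \<and> (k, j) \<in> E \<and> (k, j') \<in> E} > t} \<le> card {..<n}"
    by (intro card_mono) auto
  then show "card {j'. j' < n \<and> card {k. k < n \<and> (k, j) \<in> E \<and> (k, j') \<in> E} > t} \<le> t" using assms by simp
qed

theorem corollary4p3:
  shows "\<exists>c::real. c \<ge> 1 \<and>
    (\<forall>n::nat. n \<ge> 1 \<longrightarrow>
      (\<exists>E. E \<subseteq> {..<n} \<times> {..<n} \<and> unconditional_units c n E \<and>
        real (card {matrix_unit n i j | i j. (i, j) \<in> E}) \<ge> real n powr (3/2)))"
proof (intro exI[of _ "sqrt 32"] conjI allI impI)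
  fix n :: nat assume n: "n \<ge> 1"
  \<comment> \<open>For \<open>n < 16\<close> all matrix units are taken; there are too few columns to violate the overlap condition.\<close>
  have "\<exists>E \<subseteq> {..<n} \<times> {..<n}. few_column_overlaps 16 n E \<and> few_column_overlaps 16 n (E\<inverse>) \<and>
    real n powr (3/2) \<le> real (card E)"
  proof (cases "n \<ge> 16")
    case False
    have "n ^ 3 \<le> (n\<^sup>2)\<^sup>2" using n by (simp add: power_increasing flip: power_mult)
    then have "real n powr (3/2) \<le> real (card ({..<n} \<times> {..<n}))"
      using powr_three_halves_le[of n "n\<^sup>2"] by (simp add: card_cartesian_product power2_eq_square)
    then show ?thesis using False few_column_overlaps_small[of n 16]
      by (intro exI[of _ "{..<n} \<times> {..<n}"]) auto
  qed (rule ex_large_pattern)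
  then obtain E where E: "E \<subseteq> {..<n} \<times> {..<n}" "few_column_overlaps 16 n E" "few_column_overlaps 16 n (E\<inverse>)"
    "real n powr (3/2) \<le> real (card E)" by blast
  have "unconditional_units (sqrt 32) n E"
    using unconditional_units_of_few_overlaps[OF _ E(1-3)] by simp
  then show "\<exists>E. E \<subseteq> {..<n} \<times> {..<n} \<and> unconditional_units (sqrt 32) n E \<and>
      real (card {matrix_unit n i j | i j. (i, j) \<in> E}) \<ge> real n powr (3/2)"
    using E card_matrix_units[OF E(1)] by (intro exI[of _ E]) simp
qed simp

end
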